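(* Let $q\ge 3$, $r\in\mathbb{N}$, $s\in\mathbb{N}$, and let $Y_s=\{y_i\}_{i=1}^{2s}$ be any collection of points with $y_{2s}<y_{2s-1}<\cdots<y_1<y_{2s}+2\pi=:y_0$. Then there exists a function $f\in\Delta^{(q)}(Y_s)\cap W^r$ such that $$\limsup_{n\to\infty} n^r E_n^{(q)}(f,Y_s)=\infty.$$
   Context: A function $f\in C[a,b]$ is called $q$-monotone ($q\ge 2$) if $f\in C^{q-2}(a,b)$ and $f^{(q-2)}$ is convex on $(a,b)$. For $Y_s$ as in the claim, $\Delta^{(q)}(Y_s)$ denotes the set of continuous $2\pi$-periodic functions $f:\mathbb{R}\to\mathbb{R}$ such that $(-1)^{i-1}f$ is $q$-monotone on $[y_i,y_{i-1}]$ for each $1\le i\le 2s$. $W^r$ denotes the class of $2\pi$-periodic functions $f$ with $f^{(r-1)}$ locally absolutely continuous on $\mathbb{R}$ and $\operatorname{ess\,sup}_{x\in\mathbb{R}}|f^{(r)}(x)|\le 2$. $\mathcal{T}_n$ is the space of real trigonometric polynomials $\alpha_0+\sum_{k=1}^n(\alpha_k\cos kt+\beta_k\sin kt)$ of degree $\le n$. For a continuous $2\pi$-periodic $g$, $\|g\|=\max_{x\in\mathbb{R}}|g(x)|$, and $E_n^{(q)}(g,Y_s):=\inf_{T_n\in\mathcal{T}_n\cap\Delta^{(q)}(Y_s)}\|g-T_n\|$. *)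

theory Defs
  imports "HOL-Analysis.Analysis" "HOL-Library.Liminf_Limsup"
begin

definition nderiv :: "nat \<Rightarrow> (real \<Rightarrow> real) \<Rightarrow> real \<Rightarrow> real" where
  "nderiv k f = (deriv ^^ k) f"

definition Ck_open :: "nat \<Rightarrow> real \<Rightarrow> real \<Rightarrow> (real \<Rightarrow> real) \<Rightarrow> bool" where
  "Ck_open k a b f \<longleftrightarrow>
     (\<forall>j<k. \<forall>x\<in>{a<..<b}. nderiv j f differentiable at x) \<and>
     continuous_on {a<..<b} (nderiv k f)"

definition q_monotone :: "nat \<Rightarrow> real \<Rightarrow> real \<Rightarrow> (real \<Rightarrow> real) \<Rightarrow> bool" where
  "q_monotone q a b f \<longleftrightarrow>
     continuous_on {a..b} f \<and> Ck_open (q - 2) a b f \<and>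
     convex_on {a<..<b} (nderiv (q - 2) f)"

definition periodic2pi :: "(real \<Rightarrow> real) \<Rightarrow> bool" where
  "periodic2pi f \<longleftrightarrow> (\<forall>x. f (x + 2 * pi) = f x)"

definition ypt :: "(nat \<Rightarrow> real) \<Rightarrow> nat \<Rightarrow> nat \<Rightarrow> real" where
  "ypt y s i = (if i = 0 then y (2 * s) + 2 * pi else y i)"

definition Delta_q :: "nat \<Rightarrow> (nat \<Rightarrow> real) \<Rightarrow> nat \<Rightarrow> (real \<Rightarrow> real) set" where
  "Delta_q q y s = {f. continuous_on UNIV f \<and> periodic2pi f \<and>
     (\<forall>i\<in>{1..2 * s}. q_monotone q (ypt y s i) (ypt y s (i - 1))
                       (\<lambda>x. (-1) ^ (i - 1) * f x))}"

definition abs_cont_on :: "real \<Rightarrow> real \<Rightarrow> (real \<Rightarrow> real) \<Rightarrow> bool" where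
  "abs_cont_on a b g \<longleftrightarrow>
     (\<forall>\<epsilon>>0. \<exists>\<delta>>0. \<forall>(n::nat) (u::nat \<Rightarrow> real) (v::nat \<Rightarrow> real).
        (\<forall>k<n. a \<le> u k \<and> u k \<le> v k \<and> v k \<le> b) \<and>
        (\<forall>k<n. \<forall>l<n. k \<noteq> l \<longrightarrow> v k \<le> u l \<or> v l \<le> u k) \<and>
        (\<Sum>k<n. v k - u k) < \<delta>
        \<longrightarrow> (\<Sum>k<n. \<bar>g (v k) - g (u k)\<bar>) < \<epsilon>)"

definition loc_abs_cont :: "(real \<Rightarrow> real) \<Rightarrow> bool" where
  "loc_abs_cont g \<longleftrightarrow> (\<forall>a b. a \<le> b \<longrightarrow> abs_cont_on a b g)"

definition W_class :: "nat \<Rightarrow> (real \<Rightarrow> real) set" where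
  "W_class r = {f. periodic2pi f \<and>
     (\<forall>j<r - 1. \<forall>x. nderiv j f differentiable at x) \<and>
     loc_abs_cont (nderiv (r - 1) f) \<and>
     (AE x in lborel. nderiv (r - 1) f differentiable at x \<and> \<bar>nderiv r f x\<bar> \<le> 2)}"

definition trig_poly :: "nat \<Rightarrow> (real \<Rightarrow> real) set" where
  "trig_poly n = {T. \<exists>a b :: nat \<Rightarrow> real. \<forall>x.
      T x = a 0 + (\<Sum>k=1..n. a k * cos (real k * x) + b k * sin (real k * x))}"

definition sup_norm :: "(real \<Rightarrow> real) \<Rightarrow> real" where
  "sup_norm g = (SUP x. \<bar>g x\<bar>)"

definition E_q :: "nat \<Rightarrow> nat \<Rightarrow> (real \<Rightarrow> real) \<Rightarrow> (nat \<Rightarrow> real) \<Rightarrow> nat \<Rightarrow> real" where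
  "E_q q n g y s = (INF T\<in>trig_poly n \<inter> Delta_q q y s. sup_norm (\<lambda>x. g x - T x))"

end

theory Submission
  imports Defs
begin

text \<open>
  If \<open>T\<close> is an admissible polynomial of degree \<open>n\<close>, then its derivative of order \<open>q - 1\<close> decreases
  left of \<open>y 1\<close> and increases right of it, so \<open>y 1\<close> is a local minimum of that derivative. For
  \<open>r = 1\<close> this rules out any upward jump in the limit of the derivatives of order \<open>q - 2\<close>, although
  functions with such a jump at \<open>y 1\<close> are admissible. For \<open>r \<ge> 2\<close> consider \<open>f\<close> whose derivative of
  order \<open>q - 1\<close> drops by \<open>a\<close> within distance \<open>\<eta> \<lless> 1/n\<close> left of \<open>y 1\<close> and stays there. By a local Bernstein
  inequality \<open>T\<close> must start its own drop at distance about \<open>1/n\<close> before \<open>y 1\<close>, which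
  changes the increment of the derivative of order \<open>q - 2\<close> by about \<open>a/n\<close>; as \<open>f\<close> is a
  polynomial of degree less than \<open>q\<close> around, nothing can compensate, and the error is at least of order
  \<open>a/n\<close>. The class \<open>W_class r\<close> allows \<open>a\<close> of order \<open>\<eta> ^ (r - q + 1)\<close>, so the error exceeds
  \<open>n powr (-r)\<close> by an unbounded factor, and a gliding hump argument combines infinitely many scales.
\<close>

section \<open>Trigonometric polynomials and a local Bernstein inequality\<close>

text \<open>At scale \<open>\<eta>\<close> of order \<open>1/n\<close> the forced error
  \<open>a/n\<close> has order \<open>n powr (-e - 1)\<close>, where \<open>e\<close> is the larger
  of \<open>r - q + 1\<close> and 0. The gain over \<open>n powr (-r)\<close> is therefore
  \<open>n powr (r - e - 1)\<close>, and \<open>q \<ge> 3\<close>, \<open>r \<ge> 2\<close> make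
  this exponent positive. For \<open>r = 1\<close> it is zero, which is why order one has its own
  construction; there the error stays above one positive constant for all degrees. The obstacle in
  combining scales is that the constant of the one-scale bound depends on the window in which the
  function has the simple shape, and each earlier hump shrinks the next window. Nothing is known
  about how fast the constant deteriorates, so at every stage the degree is chosen last, after
  window and weight, and the positive power of \<open>n\<close> absorbs any constant. Periodicity
  forces each hump to return to its first level. The return takes place at a fixed scale right of
  \<open>y 1\<close>, where increase is allowed; only the descent is steep.\<close>

lemma trig_poly_const: "(\<lambda>x. c) \<in> trig_poly n"
  unfolding trig_poly_def
  by (rule CollectI, rule exI[of _ "\<lambda>k. if k = 0 then c else 0"], rule exI[of _ "\<lambda>k. 0"]) auto

lemma trig_poly_cos:
  assumes "k \<le> n" shows "(\<lambda>x. cos (real k * x)) \<in> trig_poly n"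
proof (cases "k = 0")
  case True then show ?thesis using trig_poly_const[of 1 n] by simp
next
  case False
  then show ?thesis using assms unfolding trig_poly_def
    by (intro CollectI exI[of _ "\<lambda>j. if j = k then 1 else 0"] exI[of _ "\<lambda>k. 0"])
      (auto simp: if_distrib[where f="\<lambda>u. u * _"] cong: if_cong)
qed

lemma trig_poly_sin:
  assumes "k \<le> n" shows "(\<lambda>x. sin (real k * x)) \<in> trig_poly n"
proof (cases "k = 0")
  case True then show ?thesis using trig_poly_const[of 0 n] by simp
next
  case False
  then show ?thesis using assms unfolding trig_poly_def
    by (intro CollectI exI[of _ "\<lambda>j. if j = k then 1 else 0"] exI[of _ "\<lambda>k. 0"])
      (auto simp: if_distrib[where f="\<lambda>u. u * _"]
        intro!: exI[of _ "\<lambda>k. 0"] exI[of _ "\<lambda>j. if j = k then 1 else 0"] cong: if_cong)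
qed

lemma trig_poly_add:
  assumes "S \<in> trig_poly n" "T \<in> trig_poly n" shows "(\<lambda>x. S x + T x) \<in> trig_poly n"
proof -
  obtain a b where 1: "\<And>x. S x = a 0 + (\<Sum>k=1..n. a k * cos (real k * x) + b k * sin (real k * x))"
    using assms(1) unfolding trig_poly_def by blast
  obtain c d where 2: "\<And>x. T x = c 0 + (\<Sum>k=1..n. c k * cos (real k * x) + d k * sin (real k * x))"
    using assms(2) unfolding trig_poly_def by blast
  show ?thesis unfolding trig_poly_def
    by (intro CollectI exI[of _ "\<lambda>k. a k + c k"] exI[of _ "\<lambda>k. b k + d k"])
      (simp add: 1 2 sum.distrib[symmetric] algebra_simps)
qed

lemma trig_poly_cmult:
  assumes "T \<in> trig_poly n" shows "(\<lambda>x. c * T x) \<in> trig_poly n"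
proof -
  obtain a b where 1: "\<And>x. T x = a 0 + (\<Sum>k=1..n. a k * cos (real k * x) + b k * sin (real k * x))"
    using assms(1) unfolding trig_poly_def by blast
  show ?thesis unfolding trig_poly_def
    by (intro CollectI exI[of _ "\<lambda>k. c * a k"] exI[of _ "\<lambda>k. c * b k"])
      (simp add: 1 sum_distrib_left algebra_simps)
qed

lemma trig_poly_sum:
  assumes "\<And>i. i \<in> A \<Longrightarrow> T i \<in> trig_poly n" shows "(\<lambda>x. \<Sum>i\<in>A. T i x) \<in> trig_poly n"
  using assms by (induction A rule: infinite_finite_induct) (auto intro: trig_poly_add trig_poly_const)

lemma trig_polyE:
  assumes "T \<in> trig_poly n"
  obtains a b where "T = (\<lambda>x. a 0 + (\<Sum>k=1..n. a k * cos (real k * x) + b k * sin (real k * x)))"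
  using assms unfolding trig_poly_def by blast

lemma trig_poly_mono:
  assumes "T \<in> trig_poly m" "m \<le> n" shows "T \<in> trig_poly n"
proof -
  obtain a b where T: "T = (\<lambda>x. a 0 + (\<Sum>k=1..m. a k * cos (real k * x) + b k * sin (real k * x)))"
    using assms(1) by (rule trig_polyE)
  show ?thesis unfolding T using assms(2)
    by (intro trig_poly_add trig_poly_sum trig_poly_const trig_poly_cmult trig_poly_cos trig_poly_sin) auto
qed

lemma trig_poly_shift:
  assumes "T \<in> trig_poly n" shows "(\<lambda>x. T (c + x)) \<in> trig_poly n"
proof -
  obtain a b where T: "T = (\<lambda>x. a 0 + (\<Sum>k=1..n. a k * cos (real k * x) + b k * sin (real k * x)))"
    using assms(1) by (rule trig_polyE)
  have "(\<lambda>x. T (c + x)) = (\<lambda>x. a 0 + (\<Sum>k=1..n.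
     (a k * cos (real k * c) + b k * sin (real k * c)) * cos (real k * x)
     + (b k * cos (real k * c) - a k * sin (real k * c)) * sin (real k * x)))"
    unfolding T by (intro ext arg_cong[where f="\<lambda>u. a 0 + u"] sum.cong refl)
      (simp add: distrib_left cos_add sin_add algebra_simps)
  also have "\<dots> \<in> trig_poly n"
    by (intro trig_poly_add trig_poly_sum trig_poly_const trig_poly_cmult trig_poly_cos trig_poly_sin) auto
  finally show ?thesis .
qed

lemma trig_poly_has_derivative:
  assumes "T \<in> trig_poly n"
  obtains T' where "T' \<in> trig_poly n" "\<And>x. (T has_real_derivative T' x) (at x)"
proof -
  obtain a b where T: "T = (\<lambda>x. a 0 + (\<Sum>k=1..n. a k * cos (real k * x) + b k * sin (real k * x)))"
    using assms(1) by (rule trig_polyE)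
  define T' where "T' = (\<lambda>x. \<Sum>k=1..n. (- a k * real k) * sin (real k * x) + (b k * real k) * cos (real k * x))"
  have "T' \<in> trig_poly n" unfolding T'_def
    by (intro trig_poly_add trig_poly_sum trig_poly_const trig_poly_cmult trig_poly_cos trig_poly_sin) auto
  moreover have "(T has_real_derivative T' x) (at x)" for x
    unfolding T T'_def by (auto intro!: derivative_eq_intros sum.cong simp: algebra_simps)
  ultimately show ?thesis using that by blast
qed

lemma trig_poly_deriv:
  assumes "T \<in> trig_poly n"
  shows "deriv T \<in> trig_poly n" "(T has_real_derivative deriv T x) (at x)"
proof -
  obtain T' where T': "T' \<in> trig_poly n" "\<And>x. (T has_real_derivative T' x) (at x)"
    using trig_poly_has_derivative[OF assms] by blast
  have "deriv T = T'" using T'(2) DERIV_imp_deriv by blast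
  with T' show "deriv T \<in> trig_poly n" "(T has_real_derivative deriv T x) (at x)" by auto
qed

lemma trig_poly_nderiv:
  assumes "T \<in> trig_poly n"
  shows "nderiv j T \<in> trig_poly n" "(nderiv j T has_real_derivative nderiv (Suc j) T x) (at x)"
proof -
  have *: "nderiv j T \<in> trig_poly n" for j
    by (induction j) (auto simp: nderiv_def assms trig_poly_deriv)
  show "nderiv j T \<in> trig_poly n" by (rule *)
  show "(nderiv j T has_real_derivative nderiv (Suc j) T x) (at x)"
    using trig_poly_deriv(2)[OF *[of j], of x] by (simp add: nderiv_def)
qed

section \<open>The Fejer kernel and the global Bernstein inequality\<close>

lemma has_integral_cos_period:
  "((\<lambda>t. cos (of_int k * t)) has_integral (if k = 0 then 2 * pi else 0)) {-pi..pi}"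
proof (cases "k = 0")
  case True
  then show ?thesis using has_integral_const_real[of "1::real" "-pi" pi] by simp
next
  case False
  have "((\<lambda>t. cos (of_int k * t)) has_integral (sin (of_int k * pi) / of_int k - sin (of_int k * (-pi)) / of_int k)) {-pi..pi}"
    using False by (intro fundamental_theorem_of_calculus)
      (auto intro!: derivative_eq_intros simp flip: has_real_derivative_iff_has_vector_derivative)
  moreover have "sin (of_int k * pi) = 0" by (simp add: sin_zero_iff_int2)
  ultimately show ?thesis using False by simp
qed

lemma has_integral_sin_period:
  "((\<lambda>t. sin (of_int k * t)) has_integral 0) {-pi..pi}"
proof (cases "k = 0")
  case False
  have "((\<lambda>t. sin (of_int k * t)) has_integral (- cos (of_int k * pi) / of_int k - - cos (of_int k * (-pi)) / of_int k)) {-pi..pi}"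
    using False by (intro fundamental_theorem_of_calculus)
      (auto intro!: derivative_eq_intros simp flip: has_real_derivative_iff_has_vector_derivative)
  then show ?thesis by simp
qed simp

text \<open>This is the squared modulus of the sum of \<open>exp (i j t)\<close> over
  \<open>j < m\<close>, that is, \<open>m\<close> times the usual Fejer kernel. In this form
  nonnegativity is visible, so its \<open>L1\<close> norm is its integral.\<close>

definition fejer :: "nat \<Rightarrow> real \<Rightarrow> real" where
  "fejer m t = (\<Sum>j<m. cos (real j * t))\<^sup>2 + (\<Sum>j<m. sin (real j * t))\<^sup>2"

lemma fejer_expand:
  "fejer m t = (\<Sum>j<m. \<Sum>l<m. cos (of_int (int j - int l) * t))"
  unfolding fejer_def power2_eq_square sum_product sum.distrib[symmetric]
  by (intro sum.cong refl) (simp add: left_diff_distrib cos_diff)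

text \<open>The sums count the pairs with difference \<open>k - m\<close>, respectively
  \<open>m - k\<close>, so they give the Fourier coefficient \<open>m - (m - k) = k\<close> of
  \<open>fejer m\<close> at frequency \<open>m - k\<close>. This linear growth in \<open>k\<close>
  later turns an integral into a derivative.\<close>

lemma sum_diagonal:
  assumes "k \<le> (m::nat)"
  shows "(\<Sum>j<m. \<Sum>l<m. if int k - int m - (int j - int l) = 0 then (1::real) else 0) = k"
    and "(\<Sum>j<m. \<Sum>l<m. if int k - int m + (int j - int l) = 0 then (1::real) else 0) = k"
proof -
  have "(\<Sum>l<m. if int k - int m - (int j - int l) = 0 then (1::real) else 0) = (if j < k then 1 else 0)"
    if "j < m" for j
  proof -
    have "(\<Sum>l<m. if int k - int m - (int j - int l) = 0 then (1::real) else 0)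
        = (\<Sum>l<m. if l = j + m - k then (1::real) else 0)"
      using assms by (intro sum.cong refl if_cong) auto
    also have "\<dots> = (if j < k then 1 else 0)" using assms by (auto simp: sum.delta)
    finally show ?thesis .
  qed
  then have "(\<Sum>j<m. \<Sum>l<m. if int k - int m - (int j - int l) = 0 then (1::real) else 0) = (\<Sum>j<m. if j < k then 1 else 0)"
    by (intro sum.cong) auto
  also have "\<dots> = (\<Sum>j\<in>{..<m} \<inter> {j. j < k}. 1)" by (simp add: sum.If_cases)
  also have "{..<m} \<inter> {j. j < k} = {..<k}" using assms by auto
  finally show *: "(\<Sum>j<m. \<Sum>l<m. if int k - int m - (int j - int l) = 0 then (1::real) else 0) = k" by simp
  show "(\<Sum>j<m. \<Sum>l<m. if int k - int m + (int j - int l) = 0 then (1::real) else 0) = k"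
    by (subst sum.swap, subst *[symmetric]) (intro sum.cong if_cong, auto)
qed

lemma has_integral_fejer: "(fejer m has_integral (2 * pi * m)) {-pi..pi}"
proof -
  have "((\<lambda>t. \<Sum>j<m. \<Sum>l<m. cos (of_int (int j - int l) * t)) has_integral
      (\<Sum>j<m. \<Sum>l<m. if int j - int l = 0 then 2 * pi else 0)) {-pi..pi}"
    by (intro has_integral_sum has_integral_cos_period) auto
  moreover have "(\<Sum>j<m. \<Sum>l<m. if int j - int l = 0 then 2 * pi else 0) = 2 * pi * m"
    by simp
  ultimately show ?thesis by (simp add: fejer_expand[abs_def] mult.commute)
qed

text \<open>Modulation by \<open>sin (m t)\<close> moves the frequency \<open>m - k\<close> of the
  kernel to \<open>k\<close>, so the \<open>k\<close>-th sine coefficient is proportional to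
  \<open>k\<close>: integrating against this kernel differentiates at 0.\<close>

lemma has_integral_kernel_sin:
  assumes "1 \<le> k" "k \<le> m"
  shows "((\<lambda>t. sin (real k * t) * (sin (real m * t) * fejer m t)) has_integral pi * k) {-pi..pi}"
proof -
  let ?c = "\<lambda>i t. cos (of_int i * t)"
  let ?d = "\<lambda>j l. int j - int l"
  have e: "sin (real k * t) * (sin (real m * t) * fejer m t) =
    (\<Sum>j<m. \<Sum>l<m. 1/4 * (?c (int k - int m - ?d j l) t + ?c (int k - int m + ?d j l) t
       - ?c (int k + int m - ?d j l) t - ?c (int k + int m + ?d j l) t))" for t
    unfolding fejer_expand sum_distrib_left
  proof (intro sum.cong refl)
    fix j l
    define A B C where "A = real k * t" "B = real m * t" "C = of_int (?d j l) * t"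
    have "sin A * (sin B * cos C) = 1/4 * (cos (A - B - C) + cos (A - B + C) - cos (A + B - C) - cos (A + B + C))"
      by (simp add: cos_add cos_diff sin_add sin_diff algebra_simps)
    then show "sin (real k * t) * (sin (real m * t) * cos (of_int (?d j l) * t)) =
     1/4 * (?c (int k - int m - ?d j l) t + ?c (int k - int m + ?d j l) t
       - ?c (int k + int m - ?d j l) t - ?c (int k + int m + ?d j l) t)"
      by (simp add: A_B_C_def algebra_simps)
  qed
  let ?i = "\<lambda>i::int. if i = 0 then 2 * pi else 0"
  have "((\<lambda>t. sin (real k * t) * (sin (real m * t) * fejer m t)) has_integral
    (\<Sum>j<m. \<Sum>l<m. 1/4 * (?i (int k - int m - ?d j l) + ?i (int k - int m + ?d j l)
       - ?i (int k + int m - ?d j l) - ?i (int k + int m + ?d j l)))) {-pi..pi}"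
    unfolding e by (intro has_integral_sum has_integral_mult_right has_integral_add has_integral_diff has_integral_cos_period) auto
  \<comment> \<open>The frequencies \<open>k + m\<close> plus or minus \<open>j - l\<close> never
    vanish, since \<open>\<bar>j - l\<bar> < m\<close> and \<open>k \<ge> 1\<close>; only the first
    two cosines contribute.\<close>
  also have "(\<Sum>j<m. \<Sum>l<m. 1/4 * (?i (int k - int m - ?d j l) + ?i (int k - int m + ?d j l)
       - ?i (int k + int m - ?d j l) - ?i (int k + int m + ?d j l)))
     = (\<Sum>j<m. \<Sum>l<m. pi/2 * (if int k - int m - ?d j l = 0 then 1 else 0) + pi/2 * (if int k - int m + ?d j l = 0 then 1 else 0))"
    using assms by (intro sum.cong refl) auto
  also have "\<dots> = pi/2 * (\<Sum>j<m. \<Sum>l<m. if int k - int m - ?d j l = 0 then (1::real) else 0)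
     + pi/2 * (\<Sum>j<m. \<Sum>l<m. if int k - int m + ?d j l = 0 then (1::real) else 0)"
    by (simp only: sum.distrib sum_distrib_left)
  also have "\<dots> = pi * k" using sum_diagonal[OF assms(2)] by simp
  finally show ?thesis .
qed

lemma has_integral_kernel_cos:
  "((\<lambda>t. cos (real k * t) * (sin (real m * t) * fejer m t)) has_integral 0) {-pi..pi}"
proof -
  let ?c = "\<lambda>i t. sin (of_int i * t)"
  let ?d = "\<lambda>j l. int j - int l"
  have e: "cos (real k * t) * (sin (real m * t) * fejer m t) =
    (\<Sum>j<m. \<Sum>l<m. 1/4 * (?c (int m + int k + ?d j l) t + ?c (int m + int k - ?d j l) t
       + ?c (int m - int k + ?d j l) t + ?c (int m - int k - ?d j l) t))" for t
    unfolding fejer_expand sum_distrib_left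
  proof (intro sum.cong refl)
    fix j l
    define A B C where "A = real k * t" "B = real m * t" "C = of_int (?d j l) * t"
    have "cos A * (sin B * cos C) = 1/4 * (sin (B + A + C) + sin (B + A - C) + sin (B - A + C) + sin (B - A - C))"
      by (simp add: cos_add cos_diff sin_add sin_diff algebra_simps)
    then show "cos (real k * t) * (sin (real m * t) * cos (of_int (?d j l) * t)) =
     1/4 * (?c (int m + int k + ?d j l) t + ?c (int m + int k - ?d j l) t
       + ?c (int m - int k + ?d j l) t + ?c (int m - int k - ?d j l) t)"
      by (simp add: A_B_C_def algebra_simps)
  qed
  have "((\<lambda>t. cos (real k * t) * (sin (real m * t) * fejer m t)) has_integral
    (\<Sum>j<m. \<Sum>l<m. 1/4 * (0 + 0 + 0 + 0))) {-pi..pi}"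
    unfolding e by (intro has_integral_sum has_integral_mult_right has_integral_add has_integral_diff has_integral_sin_period) auto
  then show ?thesis by simp
qed

text \<open>Up to the factor \<open>pi\<close>, the derivative at 0 is the integral of
  \<open>U\<close> against \<open>sin (m t) * fejer m t\<close>. Bounding \<open>U\<close> by
  \<open>B\<close> and the sine by 1 leaves the mass \<open>2 * pi * m\<close> of the kernel; hence
  the factor 2 compared with the sharp inequality, harmless here.\<close>

lemma bernstein_at_zero:
  assumes U: "U \<in> trig_poly m" and bd: "\<And>x. \<bar>U x\<bar> \<le> B" and d: "(U has_real_derivative d) (at 0)"
  shows "\<bar>d\<bar> \<le> 2 * real m * B"
proof -
  obtain a b where Ue: "U = (\<lambda>x. a 0 + (\<Sum>k=1..m. a k * cos (real k * x) + b k * sin (real k * x)))"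
    using U by (rule trig_polyE)
  have "(U has_real_derivative (\<Sum>k=1..m. b k * real k)) (at 0)"
    unfolding Ue by (auto intro!: derivative_eq_intros sum.cong)
  then have d': "d = (\<Sum>k=1..m. b k * real k)" using d DERIV_unique by blast
  let ?W = "\<lambda>t. sin (real m * t) * fejer m t"
  have 1: "((\<lambda>t. a 0 * (cos (real 0 * t) * ?W t) +
     (\<Sum>k=1..m. a k * (cos (real k * t) * ?W t) + b k * (sin (real k * t) * ?W t)))
     has_integral (a 0 * 0 + (\<Sum>k=1..m. a k * 0 + b k * (pi * k)))) {-pi..pi}"
    by (intro has_integral_add has_integral_sum has_integral_mult_right has_integral_kernel_sin has_integral_kernel_cos) auto
  have 2: "(\<lambda>t. a 0 * (cos (real 0 * t) * ?W t) +
     (\<Sum>k=1..m. a k * (cos (real k * t) * ?W t) + b k * (sin (real k * t) * ?W t))) = (\<lambda>t. U t * ?W t)"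
    unfolding Ue by (simp add: distrib_right sum_distrib_right mult.assoc)
  have 3: "((\<lambda>t. U t * ?W t) has_integral pi * d) {-pi..pi}"
    using 1 unfolding 2 d' by (simp add: sum_distrib_left mult.left_commute)
  have fpos: "fejer m t \<ge> 0" for t unfolding fejer_def by simp
  have B0: "0 \<le> B" using bd[of 0] by linarith
  have 4: "((\<lambda>t. B * fejer m t) has_integral B * (2 * pi * m)) {-pi..pi}"
    by (intro has_integral_mult_right has_integral_fejer)
  have 5: "\<bar>U t * ?W t\<bar> \<le> B * fejer m t" for t
  proof -
    have "\<bar>U t * ?W t\<bar> = (\<bar>U t\<bar> * \<bar>sin (real m * t)\<bar>) * fejer m t" using fpos[of t] by (simp add: abs_mult)
    also have "\<dots> \<le> (B * 1) * fejer m t"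
      by (intro mult_right_mono mult_mono bd B0 fpos) auto
    finally show ?thesis by simp
  qed
  have "pi * d \<le> B * (2 * pi * m)"
    by (rule has_integral_le[OF 3 4]) (use 5 in \<open>auto simp: abs_le_iff\<close>)
  moreover have "- (pi * d) \<le> B * (2 * pi * m)"
    by (rule has_integral_le[OF has_integral_neg[OF 3] 4]) (use 5 in \<open>auto simp: abs_le_iff\<close>)
  ultimately have "\<bar>pi * d\<bar> \<le> B * (2 * pi * m)" by (simp only: abs_le_iff)
  then have "pi * \<bar>d\<bar> \<le> pi * (2 * real m * B)" by (simp add: abs_mult mult_ac)
  then show ?thesis by simp
qed

section \<open>From the global to the local Bernstein inequality\<close>

lemma trig_poly_times_sin:
  assumes "T \<in> trig_poly n" shows "(\<lambda>x. sin x * T x) \<in> trig_poly (Suc n)"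
proof -
  obtain a b where T: "T = (\<lambda>x. a 0 + (\<Sum>k=1..n. a k * cos (real k * x) + b k * sin (real k * x)))"
    using assms(1) by (rule trig_polyE)
  have e: "(\<lambda>x. sin x * T x) = (\<lambda>x. a 0 * sin (real 1 * x) + (\<Sum>k=1..n.
     (a k / 2) * sin (real (k + 1) * x) + (- a k / 2) * sin (real (k - 1) * x)
     + ((b k / 2) * cos (real (k - 1) * x) + (- b k / 2) * cos (real (k + 1) * x))))"
    unfolding T distrib_left sum_distrib_left
  proof (intro ext arg_cong2[where f="(+)"], goal_cases)
    case (2 x)
    show ?case
    proof (intro sum.cong refl, goal_cases)
      case (1 k)
      then show ?case by (simp add: of_nat_diff left_diff_distrib distrib_right sin_add cos_add sin_diff cos_diff algebra_simps)
    qed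
  qed simp
  show ?thesis unfolding e
    by (intro trig_poly_add trig_poly_sum trig_poly_cmult trig_poly_cos trig_poly_sin) auto
qed

text \<open>The recurrence \<open>sin (A + 2 \<theta>) = 2 sin A cos (2 \<theta>) - sin (A - 2
  \<theta>)\<close> builds a polynomial \<open>g\<close> in \<open>sin \<theta>\<close>; it has two
  predecessors, hence two base cases. Instead of the polynomial itself, the second clause records
  the one consequence that is used: after contracting the argument by any \<open>\<sigma>\<close>,
  the result is still a trigonometric polynomial.\<close>

lemma sin_odd_multiple_trig_poly:
  "\<exists>g. (\<forall>\<theta>. sin ((2 * real k + 1) * \<theta>) = g (sin \<theta>)) \<and>
     (\<forall>\<sigma>. (\<lambda>\<phi>. g (\<sigma> * sin \<phi>)) \<in> trig_poly (2 * k + 1))"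
proof (induction k rule: nat_less_induct)
  case (1 k)
  consider "k = 0" | "k = 1" | j where "k = Suc (Suc j)" by (metis One_nat_def not0_implies_Suc)
  then show ?case
  proof cases
    case 1
    have "(\<lambda>\<phi>. \<sigma> * sin (real 1 * \<phi>)) \<in> trig_poly 1" for \<sigma>
      by (intro trig_poly_cmult trig_poly_sin) auto
    then show ?thesis using 1 by (intro exI[of _ "\<lambda>s. s"]) auto
  next
    case 2
    have s1: "sin \<in> trig_poly 1" using trig_poly_sin[of 1 1] by simp
    have "(\<lambda>\<phi>. (3 * \<sigma>) * sin \<phi> + (-4 * \<sigma>^3) * (sin \<phi> * (sin \<phi> * sin \<phi>))) \<in> trig_poly 3" for \<sigma>
      using trig_poly_times_sin[OF trig_poly_times_sin[OF s1]] s1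
      by (intro trig_poly_add trig_poly_cmult) (auto intro: trig_poly_mono simp: eval_nat_numeral)
    moreover have "sin (3 * \<theta>) = 3 * sin \<theta> - 4 * sin \<theta> ^ 3" for \<theta> :: real
    proof -
      have "sin (3 * \<theta>) = sin (2 * \<theta> + \<theta>)" by simp
      also have "\<dots> = 2 * sin \<theta> * (cos \<theta>)\<^sup>2 + (1 - 2 * (sin \<theta>)\<^sup>2) * sin \<theta>"
        unfolding sin_add sin_double cos_double_sin by (simp add: power2_eq_square)
      finally show ?thesis unfolding cos_squared_eq by (simp add: power2_eq_square power3_eq_cube algebra_simps)
    qed
    ultimately show ?thesis using 2
      by (intro exI[of _ "\<lambda>s. 3 * s - 4 * s ^ 3"]) (auto simp: power3_eq_cube numeral_3_eq_3 algebra_simps)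
  next
    case (3 j)
    obtain g where g: "\<And>\<theta>. sin ((2 * real j + 1) * \<theta>) = g (sin \<theta>)"
      "\<And>\<sigma>. (\<lambda>\<phi>. g (\<sigma> * sin \<phi>)) \<in> trig_poly (2 * j + 1)" using 1 3 by (metis less_Suc_eq)
    obtain h where h: "\<And>\<theta>. sin ((2 * real (Suc j) + 1) * \<theta>) = h (sin \<theta>)"
      "\<And>\<sigma>. (\<lambda>\<phi>. h (\<sigma> * sin \<phi>)) \<in> trig_poly (2 * Suc j + 1)" using 1 3 by (metis less_Suc_eq)
    have "sin ((2 * real k + 1) * \<theta>) = 2 * h (sin \<theta>) * (1 - 2 * (sin \<theta>)\<^sup>2) - g (sin \<theta>)" for \<theta>
    proof -
      define A where "A = (2 * real (Suc j) + 1) * \<theta>"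
      have "sin (A + 2 * \<theta>) = 2 * sin A * cos (2 * \<theta>) - sin (A - 2 * \<theta>)"
        by (simp add: sin_add sin_diff)
      moreover have "A + 2 * \<theta> = (2 * real k + 1) * \<theta>" "A - 2 * \<theta> = (2 * real j + 1) * \<theta>"
        by (simp_all add: A_def 3 algebra_simps)
      ultimately show ?thesis using g(1) h(1) unfolding A_def cos_double_sin by simp
    qed
    moreover have "(\<lambda>\<phi>. 2 * h (\<sigma> * sin \<phi>) * (1 - 2 * (\<sigma> * sin \<phi>)\<^sup>2) - g (\<sigma> * sin \<phi>)) \<in> trig_poly (2 * k + 1)" for \<sigma>
    proof -
      have "(\<lambda>\<phi>. 2 * h (\<sigma> * sin \<phi>) + (-4 * \<sigma>\<^sup>2) * (sin \<phi> * (sin \<phi> * h (\<sigma> * sin \<phi>))) + (-1) * g (\<sigma> * sin \<phi>)) \<in> trig_poly (2 * k + 1)"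
        using trig_poly_times_sin[OF trig_poly_times_sin[OF h(2)[of \<sigma>]]] g(2)[of \<sigma>] h(2)[of \<sigma>]
        by (intro trig_poly_add trig_poly_cmult) (auto intro: trig_poly_mono simp: 3)
      then show ?thesis by (simp add: power2_eq_square algebra_simps)
    qed
    ultimately show ?thesis by (intro exI[of _ "\<lambda>s. 2 * h s * (1 - 2 * s\<^sup>2) - g s"]) auto
  qed
qed

text \<open>Only the odd part of \<open>T\<close> matters at the centre; times \<open>cos (t/2)\<close> it is a polynomial in
  \<open>sin (t/2)\<close>, so \<open>sin (t/2) = sin (w/2) sin \<phi>\<close> turns the local problem into a global one.\<close>

lemma local_bernstein_zero:
  assumes T: "T \<in> trig_poly n" and w: "0 < w" "w < pi"
    and bd: "\<And>x. \<bar>x\<bar> \<le> w \<Longrightarrow> \<bar>T x\<bar> \<le> B" and d: "(T has_real_derivative d) (at 0)"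
  shows "\<bar>d\<bar> \<le> (2 * real n + 1) / sin (w / 2) * B"
proof -
  obtain a b where Te: "T = (\<lambda>x. a 0 + (\<Sum>k=1..n. a k * cos (real k * x) + b k * sin (real k * x)))"
    using T by (rule trig_polyE)
  obtain g where g: "\<And>k \<theta>. sin ((2 * real k + 1) * \<theta>) = g k (sin \<theta>)"
     "\<And>k \<sigma>. (\<lambda>\<phi>. g k (\<sigma> * sin \<phi>)) \<in> trig_poly (2 * k + 1)"
    using sin_odd_multiple_trig_poly by metis
  define \<sigma> where "\<sigma> = sin (w / 2)"
  have \<sigma>: "0 < \<sigma>" "\<sigma> \<le> 1" "arcsin \<sigma> = w / 2" unfolding \<sigma>_def using w arcsin_sin[of "w / 2"]
    by (auto intro!: sin_gt_zero)
  define v where "v = (\<lambda>\<phi>. 2 * arcsin (\<sigma> * sin \<phi>))"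
  have \<sigma>s: "\<bar>\<sigma> * sin \<phi>\<bar> \<le> \<sigma>" for \<phi> using \<sigma>(1) by (simp add: abs_mult mult_left_le)
  have sv: "sin (v \<phi> / 2) = \<sigma> * sin \<phi>" for \<phi>
  proof -
    have "-1 \<le> \<sigma> * sin \<phi>" "\<sigma> * sin \<phi> \<le> 1" using \<sigma>s[of \<phi>] \<sigma>(2) by linarith+
    then show ?thesis by (simp add: v_def)
  qed
  have vb: "\<bar>v \<phi>\<bar> \<le> w" for \<phi>
  proof -
    have sb: "- \<sigma> \<le> \<sigma> * sin \<phi>" "\<sigma> * sin \<phi> \<le> \<sigma>" using \<sigma>s[of \<phi>] by linarith+
    have "arcsin (\<sigma> * sin \<phi>) \<le> arcsin \<sigma>" "arcsin (- \<sigma>) \<le> arcsin (\<sigma> * sin \<phi>)"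
      using sb \<sigma>(1,2) by (intro arcsin_le_arcsin; linarith)+
    then show ?thesis using \<sigma> by (simp add: v_def arcsin_minus abs_le_iff)
  qed
  define S where "S = (\<lambda>t. (T t - T (- t)) / 2)"
  define U where "U = (\<lambda>\<phi>. S (v \<phi>) * cos (v \<phi> / 2))"
  have Se: "S t = (\<Sum>k=1..n. b k * sin (real k * t))" for t
    unfolding S_def Te by (simp add: sum.distrib sum_subtractf)
  have "U = (\<lambda>\<phi>. \<Sum>k=1..n. (b k / 2) * g k (\<sigma> * sin \<phi>) + (b k / 2) * g (k - 1) (\<sigma> * sin \<phi>))"
  proof
    fix \<phi>
    \<comment> \<open>The factor \<open>cos (v \<phi> / 2)\<close> splits \<open>sin (k v)\<close>
      into sines of the odd multiples \<open>2k + 1\<close> and \<open>2k - 1\<close> of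
      \<open>v / 2\<close>, to which \<open>sin_odd_multiple_trig_poly\<close> applies.\<close>
    have "b k * sin (real k * v \<phi>) * cos (v \<phi> / 2) = (b k / 2) * g k (\<sigma> * sin \<phi>) + (b k / 2) * g (k - 1) (\<sigma> * sin \<phi>)"
      if "k \<in> {1..n}" for k
    proof -
      have 1: "(2 * real k + 1) * (v \<phi> / 2) = real k * v \<phi> + v \<phi> / 2"
        "(2 * real (k - 1) + 1) * (v \<phi> / 2) = real k * v \<phi> - v \<phi> / 2"
        using that by (auto simp: of_nat_diff algebra_simps)
      show ?thesis unfolding sv[symmetric] g(1)[symmetric] 1 by (simp add: sin_add sin_diff algebra_simps)
    qed
    then show "U \<phi> = (\<Sum>k=1..n. (b k / 2) * g k (\<sigma> * sin \<phi>) + (b k / 2) * g (k - 1) (\<sigma> * sin \<phi>))"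
      unfolding U_def Se sum_distrib_right by (intro sum.cong refl)
  qed
  also have "\<dots> \<in> trig_poly (2 * n + 1)"
    by (intro trig_poly_sum trig_poly_add trig_poly_cmult) (auto intro: trig_poly_mono[OF g(2)])
  finally have U: "U \<in> trig_poly (2 * n + 1)" .
  have Ub: "\<bar>U \<phi>\<bar> \<le> B" for \<phi>
  proof -
    have "\<bar>S (v \<phi>)\<bar> \<le> B" using bd[of "v \<phi>"] bd[of "- v \<phi>"] vb[of \<phi>] unfolding S_def by (auto simp: abs_le_iff)
    then have "\<bar>S (v \<phi>)\<bar> * \<bar>cos (v \<phi> / 2)\<bar> \<le> B * 1"
      by (intro mult_mono) auto
    then show ?thesis by (simp add: U_def abs_mult)
  qed
  have d2: "((\<lambda>t. T (- t)) has_real_derivative - d) (at 0)"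
  proof -
    have "((\<lambda>t::real. - t) has_real_derivative -1) (at 0)" by (auto intro!: derivative_eq_intros)
    then show ?thesis using DERIV_chain2[of T d "\<lambda>t. - t" 0 "-1" UNIV] d by simp
  qed
  have Sd: "(S has_real_derivative d) (at 0)"
    unfolding S_def by (auto intro!: derivative_eq_intros d d2)
  have vd: "(v has_real_derivative 2 * \<sigma>) (at 0)"
    unfolding v_def by (auto intro!: derivative_eq_intros)
  have v0: "v 0 = 0" by (simp add: v_def)
  have S0: "S 0 = 0" by (simp add: S_def)
  \<comment> \<open>At 0 the cosine factor is 1 and \<open>v\<close> has slope
    \<open>2 * \<sigma>\<close>, so \<open>U\<close> has slope \<open>2 * \<sigma> * d\<close>; the
    2 cancels against the one in \<open>bernstein_at_zero\<close>.\<close>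
  have "((\<lambda>\<phi>. S (v \<phi>)) has_real_derivative d * (2 * \<sigma>)) (at 0)"
    using DERIV_chain2[of S d v 0 "2 * \<sigma>" UNIV] Sd vd v0 by simp
  then have "(U has_real_derivative d * (2 * \<sigma>)) (at 0)"
    unfolding U_def by (auto intro!: derivative_eq_intros vd simp: v0 S0)
  from bernstein_at_zero[OF U Ub this]
  have "\<bar>d\<bar> * \<sigma> \<le> (2 * real n + 1) * B" using \<sigma>(1) by (simp add: abs_mult algebra_simps)
  then show ?thesis using \<sigma>(1) by (simp add: \<sigma>_def pos_le_divide_eq)
qed

lemma local_bernstein:
  assumes T: "T \<in> trig_poly n" and n: "1 \<le> n" and w: "0 < w" "w < pi"
    and bd: "\<And>t. t \<in> {x - w..x + w} \<Longrightarrow> \<bar>T t\<bar> \<le> B" and d: "(T has_real_derivative d) (at x)"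
  shows "\<bar>d\<bar> \<le> 3 / sin (w / 2) * real n * B"
proof -
  have s: "0 < sin (w / 2)" using w by (intro sin_gt_zero) auto
  have B: "0 \<le> B" using bd[of x] w by auto
  have "\<bar>d\<bar> \<le> (2 * real n + 1) / sin (w / 2) * B"
  proof (rule local_bernstein_zero[OF trig_poly_shift[OF T, of x] w])
    show "((\<lambda>t. T (x + t)) has_real_derivative d) (at 0)"
      using d DERIV_shift[of T d 0 x] by (simp add: add.commute)
  qed (use bd in \<open>auto simp: abs_le_iff\<close>)
  also have "\<dots> \<le> (3 * real n) / sin (w / 2) * B"
    using n s B by (intro mult_right_mono divide_right_mono) auto
  finally show ?thesis by simp
qed

text \<open>Induction on \<open>m\<close>: the derivative of order \<open>m\<close> is small at some
  point of the left third and at some point of the right third, and the mean value theorem between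
  these points, at least \<open>d / 3\<close> apart, yields a point for the next order. The constant
  depends on \<open>m\<close> and \<open>d\<close> only, neither on the function nor on the position
  of the interval.\<close>

lemma small_derivative_point:
  fixes d :: real
  assumes "0 < d"
  shows "\<exists>K>0. \<forall>\<alpha> G \<epsilon>. (\<forall>i<m. \<forall>x\<in>{\<alpha>..\<alpha> + d}. (G i has_real_derivative G (Suc i) x) (at x))
     \<longrightarrow> (\<forall>x\<in>{\<alpha>..\<alpha> + d}. \<bar>G 0 x\<bar> \<le> \<epsilon>) \<longrightarrow> (\<exists>\<xi>\<in>{\<alpha>..\<alpha> + d}. \<bar>G m \<xi>\<bar> \<le> K * \<epsilon>)"
  using assms
proof (induction m arbitrary: d)
  case 0
  then show ?case by (intro exI[of _ 1]) force
next
  case (Suc m)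
  obtain K where K: "K > 0" and KK: "\<And>\<alpha> G \<epsilon>. (\<forall>i<m. \<forall>x\<in>{\<alpha>..\<alpha> + d/3}. (G i has_real_derivative G (Suc i) x) (at x))
     \<Longrightarrow> (\<forall>x\<in>{\<alpha>..\<alpha> + d/3}. \<bar>G 0 x\<bar> \<le> \<epsilon>) \<Longrightarrow> (\<exists>\<xi>\<in>{\<alpha>..\<alpha> + d/3}. \<bar>G m \<xi>\<bar> \<le> K * \<epsilon>)"
    using Suc.IH[of "d/3"] Suc.prems by auto
  show ?case
  proof (intro exI[of _ "6 * K / d"] conjI allI impI)
    show "6 * K / d > 0" using K Suc.prems by simp
    fix \<alpha> \<epsilon> :: real and G :: "nat \<Rightarrow> real \<Rightarrow> real"
    assume G: "\<forall>i<Suc m. \<forall>x\<in>{\<alpha>..\<alpha> + d}. (G i has_real_derivative G (Suc i) x) (at x)"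
      and b: "\<forall>x\<in>{\<alpha>..\<alpha> + d}. \<bar>G 0 x\<bar> \<le> \<epsilon>"
    obtain p where p: "p \<in> {\<alpha>..\<alpha> + d/3}" "\<bar>G m p\<bar> \<le> K * \<epsilon>"
      using KK[of \<alpha> G \<epsilon>] G b Suc.prems by fastforce
    have "\<exists>\<xi>\<in>{(\<alpha> + 2*d/3)..(\<alpha> + 2*d/3) + d/3}. \<bar>G m \<xi>\<bar> \<le> K * \<epsilon>"
    proof (rule KK)
    qed (use G b Suc.prems in auto)
    then obtain s where s: "s \<in> {\<alpha> + 2*d/3..\<alpha> + d}" "\<bar>G m s\<bar> \<le> K * \<epsilon>" by (auto simp: add.commute)
    have ps: "d / 3 \<le> s - p" "p < s" using p s Suc.prems by auto
    obtain \<xi> where x: "p < \<xi>" "\<xi> < s" "G m s - G m p = (s - p) * G (Suc m) \<xi>"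
      using MVT2[of p s "G m" "G (Suc m)"] ps G p s by auto
    have "\<bar>s - p\<bar> * \<bar>G (Suc m) \<xi>\<bar> \<le> 2 * (K * \<epsilon>)" using p s x(3) by (simp flip: abs_mult)
    moreover have "d / 3 * \<bar>G (Suc m) \<xi>\<bar> \<le> \<bar>s - p\<bar> * \<bar>G (Suc m) \<xi>\<bar>"
      using ps by (intro mult_right_mono) auto
    ultimately have "\<bar>G (Suc m) \<xi>\<bar> \<le> 6 * K / d * \<epsilon>" using Suc.prems by (simp add: field_simps)
    then show "\<exists>\<xi>\<in>{\<alpha>..\<alpha> + d}. \<bar>G (Suc m) \<xi>\<bar> \<le> 6 * K / d * \<epsilon>"
      using x p s by (intro bexI[of _ \<xi>]) auto
  qed
qed

section \<open>Approximation of a step\<close>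

text \<open>Here \<open>m\<close> is \<open>q - 2\<close>. The points \<open>p1\<close>, \<open>p2\<close> of the proof control the derivative of order \<open>q - 1\<close>
  between them through monotonicity; \<open>p3\<close>, \<open>p4\<close> control the increment of the one of order \<open>q - 2\<close>.\<close>

lemma step_approximation_lower_bound:
  fixes w :: real
  assumes w: "0 < w" "w < pi"
  shows "\<exists>\<kappa>>0. \<kappa> \<le> w / 8 \<and> (\<forall>n z T F a b \<eta> \<epsilon>. 1 \<le> n \<longrightarrow> T \<in> trig_poly n \<longrightarrow>
     (\<forall>i<Suc m. \<forall>x\<in>{z-w..z+w}. (F i has_real_derivative F (Suc i) x) (at x)) \<longrightarrow>
     mono_on {z..z+w} (nderiv (Suc m) T) \<longrightarrow> antimono_on {z-w..z} (nderiv (Suc m) T) \<longrightarrow>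
     0 < a \<longrightarrow> 0 < \<eta> \<longrightarrow> \<eta> \<le> \<kappa> / real n \<longrightarrow>
     (\<forall>x\<in>{z-w..z-2*\<eta>}. F (Suc m) x = b) \<longrightarrow> (\<forall>x\<in>{z-2*\<eta>..z}. b - a \<le> F (Suc m) x) \<longrightarrow>
     (\<forall>x\<in>{z..z+w}. F (Suc m) x = b - a) \<longrightarrow>
     (\<forall>x\<in>{z-w..z+w}. \<bar>T x - F 0 x\<bar> \<le> \<epsilon>) \<longrightarrow> \<kappa> * a / real n \<le> \<epsilon>)"
proof -
  have w4: "0 < w / 4" using w by simp
  obtain K1 where K1: "K1 > 0" and KK1: "\<And>\<alpha> G \<epsilon>. (\<forall>i<Suc m. \<forall>x\<in>{\<alpha>..\<alpha> + w/4}. (G i has_real_derivative G (Suc i) x) (at x))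
     \<Longrightarrow> (\<forall>x\<in>{\<alpha>..\<alpha> + w/4}. \<bar>G 0 x\<bar> \<le> \<epsilon>) \<Longrightarrow> (\<exists>\<xi>\<in>{\<alpha>..\<alpha> + w/4}. \<bar>G (Suc m) \<xi>\<bar> \<le> K1 * \<epsilon>)"
    using small_derivative_point[OF w4, of "Suc m"] by metis
  obtain K2 where K2: "K2 > 0" and KK2: "\<And>\<alpha> G \<epsilon>. (\<forall>i<m. \<forall>x\<in>{\<alpha>..\<alpha> + w/4}. (G i has_real_derivative G (Suc i) x) (at x))
     \<Longrightarrow> (\<forall>x\<in>{\<alpha>..\<alpha> + w/4}. \<bar>G 0 x\<bar> \<le> \<epsilon>) \<Longrightarrow> (\<exists>\<xi>\<in>{\<alpha>..\<alpha> + w/4}. \<bar>G m \<xi>\<bar> \<le> K2 * \<epsilon>)"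
    using small_derivative_point[OF w4, of m] by metis
  define K where "K = max K1 K2"
  have K: "K > 0" "K1 \<le> K" "K2 \<le> K" using K1 by (auto simp: K_def)
  \<comment> \<open>The first entry is the constant of \<open>local_bernstein\<close> for half-width
    \<open>w / 4\<close>; the second makes the length \<open>h\<close> below at most
    \<open>w / 4\<close>.\<close>
  define C where "C = max (3 / sin (w / 8)) (2 / w)"
  have C: "C > 0" "3 / sin (w / 8) \<le> C" "2 / w \<le> C" using w by (auto simp: C_def less_max_iff_disj)
  \<comment> \<open>\<open>w / 8\<close> keeps the descent inside the window,
    \<open>1 / (40 * C)\<close> gives \<open>2 * \<eta> \<le> h / 10\<close>,
    \<open>1 / (2 * K)\<close> settles the case of a large error, and the remaining entry is the
    constant of the final estimate.\<close>
  define \<kappa> where "\<kappa> = min (w / 8) (min (1 / (40 * C)) (min (1 / (32 * C * K * (1 + w))) (1 / (2 * K))))"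
  have \<kappa>: "\<kappa> > 0" "\<kappa> \<le> w / 8" "\<kappa> \<le> 1 / (40 * C)" "\<kappa> \<le> 1 / (32 * C * K * (1 + w))" "\<kappa> \<le> 1 / (2 * K)"
    unfolding \<kappa>_def using w C K by auto
  show ?thesis
  proof (intro exI[of _ \<kappa>] conjI allI impI, goal_cases)
    case (3 n z T F a b \<eta> \<epsilon>)
    note n = 3(1) and T = 3(2) and F = 3(3) and mo = 3(4) and an = 3(5) and a = 3(6) and \<eta> = 3(7,8)
      and Fl = 3(9) and Fm = 3(10) and Fr = 3(11) and app = 3(12)
    define D where "D = (\<lambda>i. nderiv i T)"
    have D: "(D i has_real_derivative D (Suc i) x) (at x)" for i x
      unfolding D_def by (rule trig_poly_nderiv(2)[OF T])
    define G where "G = (\<lambda>i x. D i x - F i x)"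
    have G: "(G i has_real_derivative G (Suc i) x) (at x)" if "i < Suc m" "x \<in> {z-w..z+w}" for i x
      unfolding G_def using D F that by (auto intro!: derivative_intros)
    have G0: "\<bar>G 0 x\<bar> \<le> \<epsilon>" if "x \<in> {z-w..z+w}" for x
      using app that by (auto simp: G_def D_def nderiv_def)
    have eps0: "0 \<le> \<epsilon>" using G0[of z] w by auto
    show "\<kappa> * a / real n \<le> \<epsilon>"
    proof (cases "K * \<epsilon> \<le> a / 2")
      case False
      have "\<kappa> * a / real n \<le> \<kappa> * a / 1" using n \<kappa>(1) a by (intro divide_left_mono) auto
      also have "\<dots> \<le> 1 / (2 * K) * a" using mult_right_mono[OF \<kappa>(5), of a] a by simp
      also have "\<dots> \<le> \<epsilon>" using False K by (simp add: field_simps)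
      finally show ?thesis .
    next
      case True
      have pt1: "\<exists>\<xi>\<in>{\<alpha>..\<alpha> + w/4}. \<bar>G (Suc m) \<xi>\<bar> \<le> K * \<epsilon>" if "z - w \<le> \<alpha>" "\<alpha> + w/4 \<le> z + w" for \<alpha>
      proof -
        have "\<exists>\<xi>\<in>{\<alpha>..\<alpha> + w/4}. \<bar>G (Suc m) \<xi>\<bar> \<le> K1 * \<epsilon>"
          using that by (intro KK1) (auto intro!: G G0)
        then show ?thesis using mult_right_mono[OF K(2) eps0] by force
      qed
      have pt2: "\<exists>\<xi>\<in>{\<alpha>..\<alpha> + w/4}. \<bar>G m \<xi>\<bar> \<le> K * \<epsilon>" if "z - w \<le> \<alpha>" "\<alpha> + w/4 \<le> z + w" for \<alpha>
      proof -
        have "\<exists>\<xi>\<in>{\<alpha>..\<alpha> + w/4}. \<bar>G m \<xi>\<bar> \<le> K2 * \<epsilon>"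
          using that by (intro KK2) (auto intro!: G G0)
        then show ?thesis using mult_right_mono[OF K(3) eps0] by force
      qed
      have n0: "0 < real n" using n by simp
      have "\<eta> \<le> \<kappa> / 1" using \<eta>(2) n \<kappa>(1) by (elim order_trans) (intro divide_left_mono, auto)
      then have \<eta>w: "\<eta> \<le> w / 8" using \<kappa>(2) by simp
      \<comment> \<open>How far the derivative of \<open>T\<close> of order \<open>Suc m\<close>
        lies below the left plateau \<open>b\<close>. It increases up to \<open>z\<close> and
        decreases afterwards, so \<open>M = v z\<close> is its maximum on the window.\<close>
      define v where "v = (\<lambda>x. b - D (Suc m) x)"
      have "(\<lambda>x. b + (-1) * D (Suc m) x) \<in> trig_poly n" unfolding D_def
        by (intro trig_poly_add trig_poly_cmult trig_poly_const trig_poly_nderiv(1)[OF T])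
      then have vT: "v \<in> trig_poly n" by (simp add: v_def)
      have vd: "(v has_real_derivative - D (Suc (Suc m)) x) (at x)" for x
        unfolding v_def by (auto intro!: derivative_eq_intros D)
      have v_up: "v x \<le> v y" if "z - w \<le> x" "x \<le> y" "y \<le> z" for x y
        using an that by (auto simp: v_def D_def monotone_on_def)
      have v_down: "v y \<le> v x" if "z \<le> x" "x \<le> y" "y \<le> z + w" for x y
        using mo that by (auto simp: v_def D_def monotone_on_def)
      obtain p1 where p1: "p1 \<in> {z - w..z - 3/4*w}" "\<bar>G (Suc m) p1\<bar> \<le> K * \<epsilon>"
        using pt1[of "z - w"] w by force
      obtain p2 where p2: "p2 \<in> {z + 3/4*w..z + w}" "\<bar>G (Suc m) p2\<bar> \<le> K * \<epsilon>"
        using pt1[of "z + 3/4 * w"] w by force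
      obtain p3 where p3: "p3 \<in> {z - 3/4*w..z - w/2}" "\<bar>G m p3\<bar> \<le> K * \<epsilon>"
        using pt2[of "z - 3/4*w"] w by force
      obtain p4 where p4: "p4 \<in> {z + w/2..z + 3/4*w}" "\<bar>G m p4\<bar> \<le> K * \<epsilon>"
        using pt2[of "z + w/2"] w by force
      have "F (Suc m) p1 = b" using p1 \<eta>w w by (intro Fl[rule_format]) auto
      then have vp1: "v p1 \<ge> - (K * \<epsilon>)" using p1(2) by (simp add: G_def v_def)
      have "F (Suc m) p2 = b - a" using p2 w by (intro Fr[rule_format]) auto
      then have vp2: "v p2 \<ge> a - K * \<epsilon>" using p2(2) by (simp add: G_def v_def)
      have vl: "v x \<ge> - (K * \<epsilon>)" if "p1 \<le> x" "x \<le> z" for x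
        using v_up[of p1 x] vp1 that p1 by auto
      have vr: "v x \<ge> a - K * \<epsilon>" if "z \<le> x" "x \<le> p2" for x
        using v_down[of x p2] vp2 that p2 by auto
      define M where "M = v z"
      have M: "M \<ge> a - K * \<epsilon>" unfolding M_def using vr[of z] p2 w by auto
      then have M2: "M \<ge> a / 2" "M \<ge> K * \<epsilon>" "M > 0" using True a by auto
      \<comment> \<open>Local Bernstein needs a two-sided bound: on the left
        \<open>v \<ge> - (K * \<epsilon>)\<close>, and
        \<open>K * \<epsilon> \<le> a / 2 \<le> M\<close>.\<close>
      have vabs: "\<bar>v x\<bar> \<le> M" if "x \<in> {p1..p2}" for x
      proof (cases "x \<le> z")
        case True2: True
        then show ?thesis using vl[of x] v_up[of x z] that p1 M2 by (auto simp: M_def)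
      next
        case False
        then show ?thesis using vr[of x] v_down[of z x] that p2 M2 True a by (auto simp: M_def)
      qed
      define h where "h = 1 / (2 * C * real n)"
      have h0: "h > 0" unfolding h_def using C n0 by simp
      have hw: "h \<le> w / 4"
      proof -
        have "h \<le> 1 / (2 * C)" unfolding h_def using C n by (intro divide_left_mono) auto
        also have "\<dots> \<le> w / 4" using C w by (simp add: field_simps)
        finally show ?thesis .
      qed
      have \<eta>h: "2 * \<eta> \<le> h / 10"
      proof -
        have "\<eta> \<le> 1 / (40 * C) / real n" using \<eta>(2) \<kappa>(3) n0 by (elim order_trans) (intro divide_right_mono, auto)
        then show ?thesis by (simp add: h_def field_simps)
      qed
      \<comment> \<open>By local Bernstein the slope of \<open>v\<close> is at most
        \<open>C * n * M\<close>, so \<open>v\<close> keeps at least half of its maximum within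
        distance \<open>h = 1 / (2 * C * n)\<close> left of \<open>z\<close>: the drop of
        \<open>T\<close> starts that early.\<close>
      have vM: "v x \<ge> M / 2" if x: "z - h \<le> x" "x \<le> z" for x
      proof (cases "x = z")
        case True then show ?thesis using M2 by (simp add: M_def)
      next
        case False
        then obtain t where t: "x < t" "t < z" "v z - v x = (z - x) * - D (Suc (Suc m)) t"
          using MVT2[of x z v "\<lambda>x. - D (Suc (Suc m)) x"] x vd by auto
        have "\<bar>- D (Suc (Suc m)) t\<bar> \<le> 3 / sin (w / 4 / 2) * real n * M"
          by (rule local_bernstein[OF vT n, where w="w/4" and x = t])
            (use w vd t x hw p1 p2 in \<open>auto intro!: vabs\<close>)
        also have "\<dots> \<le> C * real n * M" using C M2 n0 by (intro mult_right_mono) auto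
        finally have 1: "\<bar>D (Suc (Suc m)) t\<bar> \<le> C * real n * M" by simp
        have "v z - v x \<le> \<bar>z - x\<bar> * \<bar>D (Suc (Suc m)) t\<bar>" using t(3) by (metis abs_ge_self abs_minus abs_mult)
        also have "\<dots> \<le> h * (C * real n * M)" using x 1 h0 by (intro mult_mono) auto
        also have "\<dots> = M / 2" using C n0 by (simp add: h_def)
        finally show ?thesis by (simp add: M_def)
      qed
      have inc: "G m y - G m x \<le> (y - x) * B"
        if "z - w \<le> x" "x \<le> y" "y \<le> z + w" "\<And>t. x < t \<Longrightarrow> t < y \<Longrightarrow> G (Suc m) t \<le> B" for x y B
      proof (cases "x = y")
        case False
        then have "x < y" using that by simp
        moreover have "(G m has_real_derivative G (Suc m) t) (at t)" if "x \<le> t" "t \<le> y" for t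
          using that \<open>z - w \<le> x\<close> \<open>y \<le> z + w\<close> by (intro G) auto
        ultimately obtain t where "x < t" "t < y" "G m y - G m x = (y - x) * G (Suc m) t"
          using MVT2[of x y "G m" "G (Suc m)"] by blast
        then show ?thesis using that by (auto intro!: mult_left_mono)
      qed simp
      \<comment> \<open>The increment of \<open>G m\<close> from \<open>p3\<close> to
        \<open>p4\<close> is split at \<open>z - h\<close>, \<open>z - 2 * \<eta>\<close> and
        \<open>z\<close>; only upper bounds are needed. Between \<open>z - h\<close> and
        \<open>z - 2 * \<eta>\<close> the approximant has dropped and \<open>F\<close> has not, a
        loss of order \<open>h * a\<close>; the other pieces gain at most multiples of
        \<open>\<epsilon>\<close> and \<open>\<eta> * a\<close>.\<close>
      have i1: "G m p4 - G m z \<le> (p4 - z) * (K * \<epsilon>)"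
      proof (rule inc)
        fix t assume "z < t" "t < p4"
        then show "G (Suc m) t \<le> K * \<epsilon>" using vr[of t] Fr p4 p2 w by (auto simp: G_def v_def)
      qed (use p4 w in auto)
      have i2: "G m z - G m (z - 2 * \<eta>) \<le> (z - (z - 2 * \<eta>)) * a"
      proof (rule inc)
        fix t assume t: "z - 2 * \<eta> < t" "t < z"
        have "v t \<ge> 0" using vM[of t] t \<eta>h h0 M2 by auto
        moreover have "b - a \<le> F (Suc m) t" using Fm t by auto
        ultimately show "G (Suc m) t \<le> a" by (auto simp: G_def v_def)
      qed (use \<eta> \<eta>w w in auto)
      have i3: "G m (z - 2 * \<eta>) - G m (z - h) \<le> ((z - 2 * \<eta>) - (z - h)) * (- (M / 2))"
      proof (rule inc)
        fix t assume t: "z - h < t" "t < z - 2 * \<eta>"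
        have "v t \<ge> M / 2" using vM[of t] t \<eta> h0 M2 by auto
        moreover have "F (Suc m) t = b" using t hw w by (intro Fl[rule_format]) auto
        ultimately show "G (Suc m) t \<le> - (M / 2)" by (auto simp: G_def v_def)
      qed (use \<eta> \<eta>h h0 hw w in auto)
      have i4: "G m (z - h) - G m p3 \<le> ((z - h) - p3) * (K * \<epsilon>)"
      proof (rule inc)
        fix t assume t: "p3 < t" "t < z - h"
        have "v t \<ge> - (K * \<epsilon>)" using vl[of t] t h0 p1 p3 by auto
        moreover have "F (Suc m) t = b" using t \<eta> \<eta>h h0 hw w p3 by (intro Fl[rule_format]) auto
        ultimately show "G (Suc m) t \<le> K * \<epsilon>" by (auto simp: G_def v_def)
      qed (use h0 hw w p3 in auto)
      have Ke: "0 \<le> K * \<epsilon>" using K eps0 by simp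
      have j1: "(p4 - z) * (K * \<epsilon>) \<le> w * (K * \<epsilon>)" using p4 w Ke by (intro mult_right_mono) auto
      have j4: "((z - h) - p3) * (K * \<epsilon>) \<le> w * (K * \<epsilon>)" using p3 w h0 Ke by (intro mult_right_mono) auto
      have j2: "(z - (z - 2 * \<eta>)) * a \<le> (h / 10) * a" using \<eta>h a by (intro mult_right_mono) auto
      have "(9 * h / 10) * (a / 4) \<le> (h - 2 * \<eta>) * (M / 2)"
        using \<eta>h h0 M2 a by (intro mult_mono) auto
      then have j3: "((z - 2 * \<eta>) - (z - h)) * (- (M / 2)) \<le> - ((9 * h / 10) * (a / 4))" by (simp add: algebra_simps)
      have "- (2 * (K * \<epsilon>)) \<le> G m p4 - G m p3" using p3(2) p4(2) by (auto simp: abs_le_iff)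
      then have "- (2 * (K * \<epsilon>)) \<le> 2 * (w * (K * \<epsilon>)) + (h / 10) * a - (9 * h / 10) * (a / 4)"
        using i1 i2 i3 i4 j1 j2 j3 j4 by linarith
      \<comment> \<open>Since \<open>9/40 - 1/10 = 1/8\<close>, the loss before
        \<open>z - 2 * \<eta>\<close> outweighs the gain after it; the balance must come from
        \<open>\<epsilon>\<close>.\<close>
      then have "h * a / 8 \<le> 2 * (1 + w) * K * \<epsilon>" by (simp add: algebra_simps)
      then have "h * a / (16 * (1 + w) * K) \<le> \<epsilon>" using w K
        by (subst pos_divide_le_eq) (simp, simp add: algebra_simps)
      moreover have "\<kappa> * a / real n \<le> h * a / (16 * (1 + w) * K)"
      proof -
        have "\<kappa> * a / real n \<le> 1 / (32 * C * K * (1 + w)) * a / real n"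
          using \<kappa>(4) a n0 by (intro divide_right_mono mult_right_mono) auto
        then show ?thesis by (simp add: h_def field_simps)
      qed
      ultimately show ?thesis by linarith
    qed
  qed (use \<kappa> in auto)
qed

section \<open>Periodic antiderivatives and smooth humps\<close>

text \<open>Derivatives are carried as families \<open>D\<close> in which \<open>D (Suc i)\<close>
  is the derivative of \<open>D i\<close>. As \<open>deriv\<close> depends only on a neighbourhood,
  such a family on an open set determines \<open>nderiv\<close> there.\<close>

lemma nderiv_eq_on_open:
  assumes S: "open S" and D: "\<And>i x. i < k \<Longrightarrow> x \<in> S \<Longrightarrow> (D i has_real_derivative D (Suc i) x) (at x)"
    and f: "\<And>x. x \<in> S \<Longrightarrow> f x = D 0 x" and j: "j \<le> k" "x \<in> S"
  shows "nderiv j f x = D j x"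
  using j
proof (induction j arbitrary: x)
  case 0
  then show ?case using f by (simp add: nderiv_def)
next
  case (Suc j)
  have "(nderiv j f has_real_derivative D (Suc j) x) (at x)"
    using Suc S by (intro has_field_derivative_transform_within_open[OF D[of j x]]) auto
  then show ?case by (simp add: nderiv_def DERIV_imp_deriv)
qed

lemma has_derivative_nderiv_on_open:
  assumes S: "open S" and D: "\<And>i x. i < k \<Longrightarrow> x \<in> S \<Longrightarrow> (D i has_real_derivative D (Suc i) x) (at x)"
    and f: "\<And>x. x \<in> S \<Longrightarrow> f x = D 0 x" and j: "j < k" "x \<in> S"
  shows "(nderiv j f has_real_derivative D (Suc j) x) (at x)"
proof (rule has_field_derivative_transform_within_open[OF D[of j x] S])
  fix y assume "y \<in> S"
  then show "D j y = nderiv j f y" using nderiv_eq_on_open[of S k D f j y] S D f j by simp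
qed (use j in auto)

section \<open>Periodic functions and their antiderivatives\<close>

lemma periodic2pi_int:
  assumes "periodic2pi f" shows "f (x + of_int k * (2 * pi)) = f x"
proof -
  have *: "f (x + real n * (2 * pi)) = f x" for n x
  proof (induction n)
    case (Suc n)
    have "f (x + real (Suc n) * (2 * pi)) = f ((x + real n * (2 * pi)) + 2 * pi)" by (simp add: algebra_simps)
    then show ?case using Suc assms by (simp add: periodic2pi_def)
  qed simp
  show ?thesis
  proof (cases "k \<ge> 0")
    case True
    then show ?thesis using *[of x "nat k"] by simp
  next
    case False
    then show ?thesis using *[of "x + of_int k * (2 * pi)" "nat (- k)"] by simp
  qed
qed

lemma period_representative:
  obtains k :: int where "x + of_int k * (2 * pi) \<in> {c..<c + 2 * pi}"
proof -
  have "of_int \<lfloor>(x - c) / (2 * pi)\<rfloor> * (2 * pi) \<le> x - c"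
    by (rule floor_divide_lower) simp
  moreover have "x - c < (of_int \<lfloor>(x - c) / (2 * pi)\<rfloor> + 1) * (2 * pi)"
    by (rule floor_divide_upper) simp
  ultimately show ?thesis using that[of "- \<lfloor>(x - c) / (2 * pi)\<rfloor>"] by (auto simp: algebra_simps)
qed

lemma periodic2pi_bounded:
  assumes "periodic2pi f" "\<And>x. x \<in> {c..c + 2 * pi} \<Longrightarrow> \<bar>f x\<bar> \<le> B"
  shows "\<bar>f x\<bar> \<le> B"
proof -
  obtain k :: int where "x + of_int k * (2 * pi) \<in> {c..<c + 2 * pi}" by (rule period_representative)
  then show ?thesis using assms(2)[of "x + of_int k * (2 * pi)"] periodic2pi_int[OF assms(1)] by auto
qed

lemma periodic2pi_continuous_bounded:
  assumes "periodic2pi f" "continuous_on UNIV f"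
  obtains B where "\<And>x. \<bar>f x\<bar> \<le> B"
proof -
  have "compact (f ` {0..0 + 2 * pi})" using assms(2) by (intro compact_continuous_image) (auto intro: continuous_on_subset)
  then obtain B where "\<And>x. x \<in> {0..0 + 2 * pi} \<Longrightarrow> \<bar>f x\<bar> \<le> B"
    by (metis compact_imp_bounded bounded_iff imageI real_norm_def)
  then show ?thesis using periodic2pi_bounded[OF assms(1)] that by blast
qed

lemma antiderivative_on_reals:
  assumes "continuous_on UNIV (h::real \<Rightarrow> real)"
  obtains H where "\<And>x. (H has_real_derivative h x) (at x)"
proof -
  have "\<And>x. isCont h x" using assms continuous_on_eq_continuous_at by blast
  then have "\<exists>H. \<forall>x. -\<infinity> < ereal x \<longrightarrow> ereal x < \<infinity> \<longrightarrow> (H has_vector_derivative h x) (at x)"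
    by (intro einterval_antiderivative) auto
  then show ?thesis using that by (auto simp: has_real_derivative_iff_has_vector_derivative)
qed

text \<open>An antiderivative is periodic only if the mean over a period vanishes, so the mean
  \<open>\<mu>\<close> is subtracted; it is a value of \<open>h\<close> by the mean value theorem.
  Normalising \<open>H\<close> to vanish at 0 bounds it over one period by
  \<open>2 * pi * (2 * B)\<close>.\<close>

lemma periodic_antiderivative:
  assumes h: "continuous_on UNIV h" "periodic2pi h" "\<And>x. \<bar>h x\<bar> \<le> B"
  obtains H \<mu> where "\<bar>\<mu>\<bar> \<le> B" "\<And>x. (H has_real_derivative h x - \<mu>) (at x)" "periodic2pi H"
    "\<And>x. \<bar>H x\<bar> \<le> 4 * pi * B"
proof -
  obtain H0 where H0: "\<And>x. (H0 has_real_derivative h x) (at x)" using antiderivative_on_reals[OF h(1)] by blast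
  define \<mu> where "\<mu> = (H0 (2 * pi) - H0 0) / (2 * pi)"
  define H where "H = (\<lambda>x. H0 x - H0 0 - \<mu> * x)"
  have H: "(H has_real_derivative h x - \<mu>) (at x)" for x
    unfolding H_def by (auto intro!: derivative_eq_intros H0)
  have H2: "H 0 = 0" "H (2 * pi) = 0" by (auto simp: H_def \<mu>_def)
  obtain t where "H0 (2 * pi) - H0 0 = (2 * pi - 0) * h t" using MVT2[of 0 "2 * pi" H0 h] H0 by auto
  then have "\<mu> = h t" by (simp add: \<mu>_def)
  then have \<mu>: "\<bar>\<mu>\<bar> \<le> B" using h(3) by simp
  have "((\<lambda>x. H (x + 2 * pi) - H x) has_real_derivative 0) (at x)" for x
  proof -
    have "((\<lambda>x. H (x + 2 * pi)) has_real_derivative h (x + 2 * pi) - \<mu>) (at x)"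
      using H[of "x + 2 * pi"] by (simp add: DERIV_shift)
    from DERIV_diff[OF this H[of x]] show ?thesis using h(2) by (simp add: periodic2pi_def)
  qed
  then have "H (x + 2 * pi) - H x = H (0 + 2 * pi) - H 0" for x
    by (rule DERIV_isconst_all[rule_format])
  then have per: "periodic2pi H" using H2 by (simp add: periodic2pi_def)
  have "\<bar>H x\<bar> \<le> 4 * pi * B" if x: "x \<in> {0..0 + 2 * pi}" for x
  proof (cases "x = 0")
    case True
    have "0 \<le> B" using h(3)[of 0] by linarith
    then show ?thesis using True H2 by simp
  next
    case False
    then obtain t where "0 < t" "H x - H 0 = (x - 0) * (h t - \<mu>)" using MVT2[of 0 x H "\<lambda>t. h t - \<mu>"] H x by auto
    then have "\<bar>H x\<bar> = \<bar>x\<bar> * \<bar>h t - \<mu>\<bar>" using H2 by (simp add: abs_mult)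
    also have "\<dots> \<le> (2 * pi) * (2 * B)" using x h(3)[of t] \<mu> by (intro mult_mono) auto
    finally show ?thesis by simp
  qed
  then have "\<bar>H x\<bar> \<le> 4 * pi * B" for x using periodic2pi_bounded[OF per] by blast
  then show ?thesis using that \<mu> H per by blast
qed

text \<open>The chain is extended at its bottom, one periodic antiderivative at a time. That
  \<open>C\<close> depends on \<open>m\<close> alone makes the bounds uniform over all
  humps.\<close>

lemma periodic_iterated_antiderivative:
  "\<exists>C\<ge>0. \<forall>h B. continuous_on UNIV h \<longrightarrow> periodic2pi h \<longrightarrow> (\<forall>x. \<bar>h x\<bar> \<le> B) \<longrightarrow>
    (\<exists>D \<mu>. (\<forall>i<m. \<forall>x. (D i has_real_derivative D (Suc i) x) (at x)) \<and>
      (\<forall>i\<le>m. continuous_on UNIV (D i) \<and> periodic2pi (D i) \<and> (\<forall>x. \<bar>D i x\<bar> \<le> C * B)) \<and> D m = (\<lambda>x. h x - \<mu>))"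
  (is "\<exists>C\<ge>0. ?Q m C")
proof (induction m)
  case 0
  show ?case
  proof (intro exI[of _ 1] conjI allI impI, goal_cases)
    case (2 h B)
    then show ?case by (intro exI[of _ "\<lambda>i. h"] exI[of _ 0]) auto
  qed simp
next
  case (Suc m)
  then obtain C where C: "C \<ge> 0" and "?Q m C" by blast
  note IH = \<open>?Q m C\<close>[rule_format]
  show ?case
  proof (intro exI[of _ "(4 * pi + 2) * C"] conjI allI impI, goal_cases)
    case 1 show ?case using C by simp
  next
    case (2 h B)
    then have B: "0 \<le> B" using abs_ge_zero[of "h 0"] by (meson order_trans)
    from IH[OF 2(1,2) 2(3)[rule_format]] obtain D \<mu>
      where D1: "\<forall>i<m. \<forall>x. (D i has_real_derivative D (Suc i) x) (at x)"
        and D2: "\<forall>i\<le>m. continuous_on UNIV (D i) \<and> periodic2pi (D i) \<and> (\<forall>x. \<bar>D i x\<bar> \<le> C * B)"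
        and D3: "D m = (\<lambda>x. h x - \<mu>)" by (elim exE conjE)
    note D = D1[rule_format] D2[rule_format, THEN conjunct1] D2[rule_format, THEN conjunct2, THEN conjunct1]
      D2[rule_format, THEN conjunct2, THEN conjunct2, rule_format] D3
    obtain H \<nu> where H: "\<bar>\<nu>\<bar> \<le> C * B" "\<And>x. (H has_real_derivative D 0 x - \<nu>) (at x)" "periodic2pi H"
      "\<And>x. \<bar>H x\<bar> \<le> 4 * pi * (C * B)"
      by (rule periodic_antiderivative[OF D(2)[OF le0] D(3)[OF le0] D(4)[OF le0]]) (rule that)
    have Hc: "continuous_on UNIV H" using H(2) by (rule DERIV_continuous_on)
    \<comment> \<open>The mean \<open>\<nu>\<close> of the old bottom level must be removed from
      that level before integrating it; its derivative, and so the rest of the chain, is unaffected.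
      Only for \<open>m = 0\<close> is the bottom also the top, hence the case distinction in the
      constant.\<close>
    define E where "E = (\<lambda>i. case i of 0 \<Rightarrow> H | Suc j \<Rightarrow> (\<lambda>x. D j x - (if j = 0 then \<nu> else 0)))"
    have E: "E 0 = H" "\<And>j. E (Suc j) = (\<lambda>x. D j x - (if j = 0 then \<nu> else 0))" by (auto simp: E_def)
    have CB: "0 \<le> C * B" "0 \<le> pi * (C * B)" using C B by auto
    show ?case
    proof (intro exI[of _ E] exI[of _ "\<mu> + (if m = 0 then \<nu> else 0)"] conjI allI impI)
      fix i x assume "i < Suc m"
      then show "(E i has_real_derivative E (Suc i) x) (at x)"
        using H(2) by (cases i) (auto simp: E intro!: derivative_eq_intros D)
    next
      fix i assume i: "i \<le> Suc m"
      show "continuous_on UNIV (E i)"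
        using i D(2) Hc by (cases i) (auto simp: E intro!: continuous_intros)
      show "periodic2pi (E i)"
        using i D(3) H(3) by (cases i) (auto simp: E periodic2pi_def)
      fix x
      show "\<bar>E i x\<bar> \<le> (4 * pi + 2) * C * B"
      proof (cases i)
        case 0
        then show ?thesis using H(4)[of x] CB by (simp add: E algebra_simps)
      next
        case (Suc j)
        then have "\<bar>E i x\<bar> \<le> 2 * (C * B)" using D(4)[of j x] H(1) i CB by (auto simp: E)
        then show ?thesis using CB by (simp add: algebra_simps)
      qed
    next
      show "E (Suc m) = (\<lambda>x. h x - (\<mu> + (if m = 0 then \<nu> else 0)))" by (auto simp: E D(5))
    qed
  qed
qed

definition periodize :: "real \<Rightarrow> (real \<Rightarrow> real) \<Rightarrow> real \<Rightarrow> real" where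
  "periodize L g x = g (x - of_int \<lfloor>(x - L) / (2 * pi)\<rfloor> * (2 * pi))"

lemma periodize_eq:
  assumes "x - of_int k * (2 * pi) \<in> {L..<L + 2 * pi}"
  shows "periodize L g x = g (x - of_int k * (2 * pi))"
proof -
  have "\<lfloor>(x - L) / (2 * pi)\<rfloor> = k"
    using assms by (intro floor_unique) (auto simp: field_simps)
  then show ?thesis by (simp add: periodize_def)
qed

lemma periodic2pi_periodize: "periodic2pi (periodize L g)"
proof -
  have "(x + 2 * pi - L) / (2 * pi) = (x - L) / (2 * pi) + 1" for x by (simp add: field_simps)
  then have "\<lfloor>(x + 2 * pi - L) / (2 * pi)\<rfloor> = \<lfloor>(x - L) / (2 * pi)\<rfloor> + 1" for x by simp
  then show ?thesis unfolding periodic2pi_def periodize_def by (simp add: algebra_simps)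
qed

text \<open>Only the seams \<open>L + 2 k pi\<close> are critical: \<open>g\<close> vanishes outside
  \<open>[\<alpha>, \<beta>]\<close>, which lies strictly inside the period, so the extension is
  zero around each seam.\<close>

lemma periodize_has_derivative:
  assumes g: "\<And>x. (g has_real_derivative g' x) (at x)"
    and 0: "\<And>x. x < \<alpha> \<or> \<beta> < x \<Longrightarrow> g x = 0" and \<alpha>\<beta>: "L < \<alpha>" "\<beta> < L + 2 * pi"
  shows "(periodize L g has_real_derivative periodize L g' x) (at x)"
proof -
  obtain k0 :: int where k0: "x + of_int k0 * (2 * pi) \<in> {L..<L + 2 * pi}" by (rule period_representative)
  define k where "k = - k0"
  have k: "x - of_int k * (2 * pi) \<in> {L..<L + 2 * pi}" using k0 by (simp add: k_def)
  define u where "u = x - of_int k * (2 * pi)"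
  have e: "periodize L g' x = g' u" using periodize_eq[OF k] by (simp add: u_def)
  show ?thesis
  proof (cases "u = L")
    case False
    have 1: "((\<lambda>y. g (y - of_int k * (2 * pi))) has_real_derivative g' u) (at x)"
      using g[of u] DERIV_shift[of g "g' u" x "- (of_int k * (2 * pi))"] by (simp add: u_def)
    show ?thesis unfolding e
      by (rule has_field_derivative_transform_within_open[OF 1, of "{L + of_int k * (2*pi)<..<L + 2 * pi + of_int k * (2*pi)}"])
        (use k False in \<open>auto simp: u_def periodize_eq[of _ k]\<close>)
  next
    case True
    have "(g has_real_derivative 0) (at L)"
      using \<alpha>\<beta> by (intro has_field_derivative_transform_within_open[OF DERIV_const[of 0], of "{..<\<alpha>}"]) (auto simp: 0)
    then have g'L: "g' L = 0" using g DERIV_unique by blast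
    define \<delta> where "\<delta> = min (\<alpha> - L) (L + 2 * pi - \<beta>)"
    define \<delta>' where "\<delta>' = min \<delta> (2 * pi)"
    have \<delta>: "\<delta>' > 0" "\<delta>' \<le> \<alpha> - L" "\<delta>' \<le> L + 2 * pi - \<beta>" "\<delta>' \<le> 2 * pi" using \<alpha>\<beta> by (auto simp: \<delta>_def \<delta>'_def)
    have x: "x = L + of_int k * (2 * pi)" using True by (simp add: u_def)
    have z: "periodize L g y = 0" if "y \<in> {x - \<delta>'<..<x + \<delta>'}" for y
    proof (cases "y \<ge> x")
      case True
      then have "periodize L g y = g (y - of_int k * (2 * pi))" using that \<delta> x by (intro periodize_eq) auto
      also have "\<dots> = 0" using that \<delta> x by (intro 0) auto
      finally show ?thesis .
    next
      case False
      then have "periodize L g y = g (y - of_int (k - 1) * (2 * pi))"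
        using that \<delta> x by (intro periodize_eq) (auto simp: algebra_simps)
      also have "\<dots> = 0" using that \<delta> x by (intro 0) (auto simp: algebra_simps)
      finally show ?thesis .
    qed
    show ?thesis unfolding e True g'L
      by (rule has_field_derivative_transform_within_open[OF DERIV_const[of 0], of "{x - \<delta>'<..<x + \<delta>'}"])
        (use \<delta> z in auto)
  qed
qed

text \<open>Stated through the existence of a derivative function rather than through
  \<open>deriv\<close>, so that closure under sums, products and affine substitutions follows by
  plain induction.\<close>

primrec smooth :: "nat \<Rightarrow> (real \<Rightarrow> real) \<Rightarrow> bool" where
  "smooth 0 f = continuous_on UNIV f"
| "smooth (Suc k) f = (\<exists>f'. (\<forall>x. (f has_real_derivative f' x) (at x)) \<and> smooth k f')"

lemma smooth_SucI:
  assumes "\<And>x. (f has_real_derivative f' x) (at x)" "smooth k f'" shows "smooth (Suc k) f"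
  using assms by auto

lemma smooth_imp_continuous: "smooth k f \<Longrightarrow> continuous_on UNIV f"
proof (cases k)
  case (Suc j)
  moreover assume "smooth k f"
  ultimately obtain f' where "\<And>x. (f has_real_derivative f' x) (at x)" by auto
  then show ?thesis using DERIV_continuous_on by blast
qed simp

lemma smooth_Suc_imp: "smooth (Suc k) f \<Longrightarrow> smooth k f"
proof (induction k arbitrary: f)
  case 0 then show ?case using smooth_imp_continuous[of "Suc 0" f] by simp
next
  case (Suc k) then show ?case by (metis smooth.simps(2))
qed

lemma smooth_add: "smooth k f \<Longrightarrow> smooth k g \<Longrightarrow> smooth k (\<lambda>x. f x + g x)"
proof (induction k arbitrary: f g)
  case 0 then show ?case by (auto intro: continuous_intros)
next
  case (Suc k)
  obtain f' g' where *: "\<And>x. (f has_real_derivative f' x) (at x)" "smooth k f'"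
     "\<And>x. (g has_real_derivative g' x) (at x)" "smooth k g'" using Suc.prems by auto
  have "((\<lambda>x. f x + g x) has_real_derivative f' x + g' x) (at x)" for x by (rule DERIV_add[OF *(1) *(3)])
  from smooth_SucI[OF this Suc.IH[OF *(2,4)]] show ?case .
qed

lemma smooth_mult: "smooth k f \<Longrightarrow> smooth k g \<Longrightarrow> smooth k (\<lambda>x. f x * g x)"
proof (induction k arbitrary: f g)
  case 0 then show ?case by (auto intro: continuous_intros)
next
  case (Suc k)
  obtain f' g' where *: "\<And>x. (f has_real_derivative f' x) (at x)" "smooth k f'"
     "\<And>x. (g has_real_derivative g' x) (at x)" "smooth k g'" using Suc.prems by auto
  have "smooth k f" "smooth k g" using Suc.prems smooth_Suc_imp by blast+
  then have "smooth k (\<lambda>x. f' x * g x + f x * g' x)"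
    using *(2,4) by (intro smooth_add Suc.IH)
  moreover have "((\<lambda>x. f x * g x) has_real_derivative f' x * g x + f x * g' x) (at x)" for x
    using *(1,3) by (auto intro!: derivative_eq_intros)
  ultimately show ?case by (intro smooth_SucI[where f'="\<lambda>x. f' x * g x + f x * g' x"])
qed

lemma smooth_const: "smooth k (\<lambda>x. c)"
proof (induction k arbitrary: c)
  case (Suc k)
  then show ?case by (auto intro!: exI[of _ "\<lambda>x. 0"])
qed auto

lemma smooth_affine: "smooth k f \<Longrightarrow> smooth k (\<lambda>x. f (c + d * x))"
proof (induction k arbitrary: f)
  case 0 then show ?case by (auto intro!: continuous_intros intro: continuous_on_compose2)
next
  case (Suc k)
  obtain f' where *: "\<And>x. (f has_real_derivative f' x) (at x)" "smooth k f'" using Suc.prems by auto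
  have "((\<lambda>x. f (c + d * x)) has_real_derivative f' (c + d * x) * d) (at x)" for x
    by (rule DERIV_chain2[OF *(1)]) (auto intro!: derivative_eq_intros)
  moreover have "smooth k (\<lambda>x. f' (c + d * x) * d)" by (intro smooth_mult smooth_const Suc.IH *)
  ultimately show ?case by (intro smooth_SucI[where f'="\<lambda>x. f' (c + d * x) * d"])
qed

lemma truncated_power_has_derivative:
  "((\<lambda>t. max 0 t ^ Suc (Suc k)) has_real_derivative real (Suc (Suc k)) * max 0 t ^ Suc k) (at (t::real))"
proof -
  consider "t > 0" | "t < 0" | "t = 0" by linarith
  then show ?thesis
  proof cases
    case 1
    have "((\<lambda>t. t ^ Suc (Suc k)) has_real_derivative real (Suc (Suc k)) * max 0 t ^ Suc k) (at t)"
      using DERIV_pow[of "Suc (Suc k)" t] 1 by (simp add: max_def)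
    then show ?thesis
      by (rule has_field_derivative_transform_within_open[of _ _ _ "{0<..}"]) (use 1 in \<open>auto simp: max_def\<close>)
  next
    case 2
    have "((\<lambda>t. 0) has_real_derivative real (Suc (Suc k)) * max 0 t ^ Suc k) (at t)"
      using 2 by (auto simp: max_def)
    then show ?thesis
      by (rule has_field_derivative_transform_within_open[of _ _ _ "{..<0}"]) (use 2 in \<open>auto simp: max_def\<close>)
  next
    case 3
    have "(\<lambda>h::real. max 0 h ^ Suc (Suc k) / h) \<midarrow>0\<rightarrow> 0"
    proof (rule Lim_null_comparison)
      have "norm (max 0 h ^ Suc (Suc k) / h) \<le> \<bar>h\<bar> ^ Suc k" for h :: real
        by (cases "h > 0") (auto simp: max_def simp del: power_Suc, simp)
      then show "\<forall>\<^sub>F h in at 0. norm (max 0 h ^ Suc (Suc k) / h) \<le> \<bar>h\<bar> ^ Suc k" by simp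
      show "(\<lambda>h::real. \<bar>h\<bar> ^ Suc k) \<midarrow>0\<rightarrow> 0" by (auto intro!: tendsto_eq_intros)
    qed
    then show ?thesis using 3 by (simp add: DERIV_def)
  qed
qed

lemma smooth_truncated_power: "smooth k (\<lambda>t. max 0 t ^ Suc k)"
proof (induction k)
  case 0 show ?case by (auto intro!: continuous_intros)
next
  case (Suc k)
  then show ?case using truncated_power_has_derivative[of k]
    by (intro smooth_SucI[where f'="\<lambda>t. real (Suc (Suc k)) * max 0 t ^ Suc k"] smooth_mult smooth_const)
qed

lemma smooth_nderiv:
  assumes "smooth k f"
  shows "i < k \<Longrightarrow> (nderiv i f has_real_derivative nderiv (Suc i) f x) (at x)"
    and "i \<le> k \<Longrightarrow> continuous_on UNIV (nderiv i f)"
proof -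
  have *: "i \<le> k \<Longrightarrow> smooth (k - i) (nderiv i f)" for i
  proof (induction i)
    case 0 then show ?case using assms by (simp add: nderiv_def)
  next
    case (Suc i)
    then obtain f' where f': "\<And>x. (nderiv i f has_real_derivative f' x) (at x)" "smooth (k - Suc i) f'"
      by (metis Suc_diff_Suc Suc_leD Suc_le_lessD smooth.simps(2))
    then have "nderiv (Suc i) f = f'" by (auto simp: nderiv_def DERIV_imp_deriv)
    then show ?case using f' by simp
  qed
  show "i \<le> k \<Longrightarrow> continuous_on UNIV (nderiv i f)" using * smooth_imp_continuous by blast
  assume "i < k"
  then obtain f' where f': "\<And>x. (nderiv i f has_real_derivative f' x) (at x)"
    using *[of i] by (metis Suc_diff_Suc less_imp_le smooth.simps(2))
  then have "nderiv (Suc i) f x = f' x" by (auto simp: nderiv_def intro: DERIV_imp_deriv)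
  then show "(nderiv i f has_real_derivative nderiv (Suc i) f x) (at x)" using f' by simp
qed

text \<open>The normalised antiderivative of a spline bump supported on \<open>[1, 2]\<close>;
  finite smoothness suffices. With these thresholds, rescaling by \<open>\<eta>\<close> confines the
  transition to distances between \<open>\<eta>\<close> and \<open>2 * \<eta>\<close>.\<close>

lemma smooth_step_exists:
  obtains \<sigma> where "smooth (Suc e) \<sigma>" "mono \<sigma>" "\<And>t. t \<le> 1 \<Longrightarrow> \<sigma> t = 0" "\<And>t. t \<ge> 2 \<Longrightarrow> \<sigma> t = (1::real)"
proof -
  define b where "b = (\<lambda>t::real. max 0 (-1 + 1 * t) ^ Suc e * max 0 (2 + (-1) * t) ^ Suc e)"
  have b: "smooth e b" unfolding b_def
    by (intro smooth_mult smooth_affine[where f="\<lambda>t. max 0 t ^ Suc e"] smooth_truncated_power)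
  obtain H where H: "\<And>x. (H has_real_derivative b x) (at x)"
    using antiderivative_on_reals smooth_imp_continuous[OF b] by blast
  have b0: "b t \<ge> 0" "t \<le> 1 \<Longrightarrow> b t = 0" "t \<ge> 2 \<Longrightarrow> b t = 0" "1 < t \<Longrightarrow> t < 2 \<Longrightarrow> b t > 0" for t
    by (auto simp: b_def max_def)
  obtain t where "1 < t" "t < 2" "H 2 - H 1 = (2 - 1) * b t" using MVT2[of 1 2 H b] H by auto
  then have pos: "H 2 - H 1 > 0" using b0(4) by simp
  have mono: "H x \<le> H y" if "x \<le> y" for x y
    using that DERIV_nonneg_imp_nondecreasing[of x y H] H b0(1) by blast
  have l: "H t = H 1" if "t \<le> 1" for t
  proof (cases "t = 1")
    case False
    then have "t < 1" using that by simp
    then obtain u where "t < u" "u < 1" "H 1 - H t = (1 - t) * b u" using MVT2[of t 1 H b] H by blast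
    then show ?thesis using b0(2)[of u] by simp
  qed simp
  have r: "H t = H 2" if "t \<ge> 2" for t
  proof (cases "t = 2")
    case False
    then have "2 < t" using that by simp
    then obtain u where "2 < u" "u < t" "H t - H 2 = (t - 2) * b u" using MVT2[of 2 t H b] H by blast
    then show ?thesis using b0(3)[of u] by simp
  qed simp
  define \<sigma> where "\<sigma> = (\<lambda>t. (H t - H 1) / (H 2 - H 1))"
  have "(\<sigma> has_real_derivative b t * (1 / (H 2 - H 1))) (at t)" for t
    unfolding \<sigma>_def using H pos by (auto intro!: derivative_eq_intros)
  moreover have "smooth e (\<lambda>t. b t * (1 / (H 2 - H 1)))" by (intro smooth_mult smooth_const b)
  ultimately have "smooth (Suc e) \<sigma>" by (rule smooth_SucI)
  moreover have "mono \<sigma>" unfolding \<sigma>_def using pos by (intro monoI divide_right_mono) (auto intro: mono)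
  moreover have "\<sigma> t = 0" if "t \<le> 1" for t unfolding \<sigma>_def l[OF that] by simp
  moreover have "\<sigma> t = 1" if "t \<ge> 2" for t unfolding \<sigma>_def r[OF that] using pos by simp
  ultimately show ?thesis by (rule that)
qed

text \<open>Level \<open>m\<close> is built first, as minus a plateau bump around \<open>z\<close>
  with a flank of scale \<open>\<eta>\<close> on the left and one of fixed scale
  \<open>\<eta>0\<close> on the right. Lower levels are periodic antiderivatives, higher ones are
  derivatives; \<open>e\<close> derivatives of the steep flank grow at most like
  \<open>1 / \<eta> ^ e\<close>. Removing the mean shifts the two plateau values from 0 and -1 to
  \<open>\<mu>\<close> and \<open>\<mu> - 1\<close>.\<close>

lemma hump_exists:
  fixes L z \<eta>0 \<eta>1 :: real
  assumes e0: "0 < \<eta>0" "\<eta>0 \<le> 1" "z + 2 * \<eta>0 < L + 2 * pi" and e1: "\<eta>1 \<le> 1" "L < z - 2 * \<eta>1"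
  shows "\<exists>C>0. \<forall>\<eta>. 0 < \<eta> \<longrightarrow> \<eta> \<le> \<eta>1 \<longrightarrow> (\<exists>D \<mu>.
     (\<forall>i<m + e. \<forall>x. (D i has_real_derivative D (Suc i) x) (at x)) \<and>
     (\<forall>i\<le>m + e. \<forall>x. \<bar>D i x\<bar> * \<eta> ^ e \<le> C) \<and> periodic2pi (D 0) \<and>
     (\<forall>x y. L \<le> x \<longrightarrow> x \<le> y \<longrightarrow> y \<le> z \<longrightarrow> D m y \<le> D m x) \<and>
     (\<forall>x y. z \<le> x \<longrightarrow> x \<le> y \<longrightarrow> y \<le> L + 2 * pi \<longrightarrow> D m x \<le> D m y) \<and>
     (\<forall>x\<in>{L..z - 2 * \<eta>}. D m x = \<mu>) \<and> (\<forall>x\<in>{z - \<eta>..z + \<eta>0}. D m x = \<mu> - 1))"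
proof -
  \<comment> \<open>One order beyond \<open>e\<close>, so that \<open>h\<close> below is
    differentiable, hence continuous, also for \<open>e = 0\<close>.\<close>
  obtain \<sigma> where \<sigma>: "smooth (Suc e) \<sigma>" "mono \<sigma>" "\<And>t. t \<le> 1 \<Longrightarrow> \<sigma> t = 0" "\<And>t. t \<ge> 2 \<Longrightarrow> \<sigma> t = 1"
    using smooth_step_exists[of e] by blast
  define S where "S = (\<lambda>i. nderiv i \<sigma>)"
  have S0: "S 0 = \<sigma>" by (simp add: S_def nderiv_def)
  have Sd: "(S i has_real_derivative S (Suc i) t) (at t)" if "i \<le> e" for i t
    unfolding S_def using smooth_nderiv(1)[OF \<sigma>(1)] that by simp
  have Sl: "S i t = 0" if "t < 1" for i t
    using nderiv_eq_on_open[of "{..<1}" i "\<lambda>_ _. 0" \<sigma> i t] \<sigma>(3) that by (auto simp: S_def)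
  have Sr: "S i t = (if i = 0 then 1 else 0)" if "t > 2" for i t
    using nderiv_eq_on_open[of "{2<..}" i "\<lambda>i _. if i = 0 then 1 else 0" \<sigma> i t] \<sigma>(4) that by (auto simp: S_def)
  have "\<exists>B. \<forall>t. \<bar>S i t\<bar> \<le> B" if "i \<le> e" for i
  proof -
    have "continuous_on UNIV (S i)" unfolding S_def using smooth_nderiv(2)[OF \<sigma>(1)] that by simp
    then have "compact (S i ` {1..2})" by (intro compact_continuous_image) (auto intro: continuous_on_subset)
    then obtain B where B: "\<And>t. t \<in> {1..2} \<Longrightarrow> \<bar>S i t\<bar> \<le> B"
      by (metis compact_imp_bounded bounded_iff imageI real_norm_def)
    have "\<bar>S i t\<bar> \<le> max B 1" for t
    proof (cases "t \<in> {1..2}")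
      case True then show ?thesis using B[of t] by auto
    next
      case False then show ?thesis using Sl[of t i] Sr[of t i] by auto
    qed
    then show ?thesis by blast
  qed
  then obtain Bf where Bf: "\<And>i t. i \<le> e \<Longrightarrow> \<bar>S i t\<bar> \<le> Bf i" by metis
  define CS where "CS = (\<Sum>i\<le>e. \<bar>Bf i\<bar>)"
  have CS: "\<bar>S i t\<bar> \<le> CS" if "i \<le> e" for i t
  proof -
    have "\<bar>S i t\<bar> \<le> \<bar>Bf i\<bar>" using Bf[OF that, of t] by linarith
    also have "\<dots> \<le> CS" unfolding CS_def using that by (intro member_le_sum) auto
    finally show ?thesis .
  qed
  have CS0: "0 \<le> CS" by (simp add: CS_def sum_nonneg)
  obtain Cm where Cm: "Cm \<ge> 0" and chain: "\<forall>h B. continuous_on UNIV h \<longrightarrow> periodic2pi h \<longrightarrow> (\<forall>x. \<bar>h x\<bar> \<le> B) \<longrightarrow>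
    (\<exists>D \<mu>. (\<forall>i<m. \<forall>x. (D i has_real_derivative D (Suc i) x) (at x)) \<and>
      (\<forall>i\<le>m. continuous_on UNIV (D i) \<and> periodic2pi (D i) \<and> (\<forall>x. \<bar>D i x\<bar> \<le> Cm * B)) \<and> D m = (\<lambda>x. h x - \<mu>))"
    using periodic_iterated_antiderivative[of m] by (elim exE conjE)
  define CB where "CB = 1 + CS + (1 / \<eta>0) ^ e * CS"
  have CB0: "CB \<ge> 0" using CS0 e0 by (simp add: CB_def)
  show ?thesis
  proof (intro exI[of _ "Cm * (1 + CS + CS) + CB + 1"] conjI allI impI)
    show "0 < Cm * (1 + CS + CS) + CB + 1"
      using mult_nonneg_nonneg[OF Cm, of "1 + CS + CS"] CS0 CB0 by linarith
    fix \<eta> :: real assume \<eta>: "0 < \<eta>" "\<eta> \<le> \<eta>1"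
    have \<eta>1: "\<eta> \<le> 1" "L < z - 2 * \<eta>" using \<eta> e1 by auto
    \<comment> \<open>For \<open>i \<le> e + 1\<close> this is the derivative of order
      \<open>i\<close> of \<open>1 - \<sigma> ((z - x) / \<eta>) - \<sigma> ((x - z) /
      \<eta>0)\<close>, which is 1 around \<open>z\<close> and 0 outside
      \<open>[z - 2 * \<eta>, z + 2 * \<eta>0]\<close>.\<close>
    define b where "b = (\<lambda>i x. (if i = 0 then 1 else 0) - (- (1 / \<eta>)) ^ i * S i ((z - x) / \<eta>) - (1 / \<eta>0) ^ i * S i ((x - z) / \<eta>0))"
    have bd: "(b i has_real_derivative b (Suc i) x) (at x)" if "i \<le> e" for i x
    proof -
      have 1: "((\<lambda>x. S i ((z - x) / \<eta>)) has_real_derivative S (Suc i) ((z - x) / \<eta>) * (- (1 / \<eta>))) (at x)"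
        by (rule DERIV_chain2[OF Sd[OF that]]) (use \<eta> in \<open>auto intro!: derivative_eq_intros\<close>)
      have 2: "((\<lambda>x. S i ((x - z) / \<eta>0)) has_real_derivative S (Suc i) ((x - z) / \<eta>0) * (1 / \<eta>0)) (at x)"
        by (rule DERIV_chain2[OF Sd[OF that]]) (use e0 in \<open>auto intro!: derivative_eq_intros\<close>)
      show ?thesis unfolding b_def
        by (rule derivative_eq_intros 1 2 refl)+ (simp add: mult.commute)
    qed
    have b0: "b i x = 0" if "x < z - 2 * \<eta> \<or> z + 2 * \<eta>0 < x" for i x
    proof (cases "x < z - 2 * \<eta>")
      case True
      then have "(z - x) / \<eta> > 2" "(x - z) / \<eta>0 < 1" using \<eta> e0 by (auto simp: field_simps)
      then show ?thesis using Sl[of "(x - z) / \<eta>0" i] Sr[of "(z - x) / \<eta>" i] by (auto simp: b_def)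
    next
      case False
      then have "(x - z) / \<eta>0 > 2" "(z - x) / \<eta> < 1" using that \<eta> e0 by (auto simp: field_simps)
      then show ?thesis using Sl[of "(z - x) / \<eta>" i] Sr[of "(x - z) / \<eta>0" i] by (auto simp: b_def)
    qed
    have bb: "\<bar>b i x\<bar> * \<eta> ^ e \<le> CB" if "i \<le> e" for i x
    proof -
      have "\<bar>b i x\<bar> \<le> 1 + (1 / \<eta>) ^ i * CS + (1 / \<eta>0) ^ i * CS"
      proof -
        have "\<bar>b i x\<bar> \<le> \<bar>(if i = 0 then 1 else 0)\<bar> + \<bar>(- (1 / \<eta>)) ^ i * S i ((z - x) / \<eta>)\<bar> + \<bar>(1 / \<eta>0) ^ i * S i ((x - z) / \<eta>0)\<bar>"
          unfolding b_def by linarith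
        also have "\<dots> \<le> 1 + (1 / \<eta>) ^ i * CS + (1 / \<eta>0) ^ i * CS"
          unfolding abs_mult power_abs using \<eta> e0 CS[OF that] by (intro add_mono mult_mono) auto
        finally show ?thesis .
      qed
      then have "\<bar>b i x\<bar> * \<eta> ^ e \<le> (1 + (1 / \<eta>) ^ i * CS + (1 / \<eta>0) ^ i * CS) * \<eta> ^ e"
        using \<eta> by (intro mult_right_mono) auto
      also have "\<dots> = \<eta> ^ e + ((1 / \<eta>) ^ i * \<eta> ^ e) * CS + ((1 / \<eta>0) ^ i * \<eta> ^ e) * CS" by (simp add: algebra_simps)
      \<comment> \<open>Here \<open>\<eta> \<le> 1\<close> and \<open>\<eta>0 \<le> 1\<close> enter:
        the chain factors of order \<open>i\<close> are dominated by those of order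
        \<open>e\<close>.\<close>
      also have "\<dots> \<le> 1 + 1 * CS + (1 / \<eta>0) ^ e * CS"
      proof (intro add_mono mult_right_mono CS0)
        show "\<eta> ^ e \<le> 1" using \<eta> \<eta>1 by (intro power_le_one) auto
        have "\<eta> ^ e = \<eta> ^ i * \<eta> ^ (e - i)" using that by (simp flip: power_add)
        then have "(1 / \<eta>) ^ i * \<eta> ^ e = \<eta> ^ (e - i)" using \<eta> by (simp add: power_divide)
        also have "\<dots> \<le> 1" using \<eta> \<eta>1 by (intro power_le_one) auto
        finally show "(1 / \<eta>) ^ i * \<eta> ^ e \<le> 1" .
        have "(1 / \<eta>0) ^ i * \<eta> ^ e \<le> (1 / \<eta>0) ^ e * 1"
          using \<open>\<eta> ^ e \<le> 1\<close> that e0 \<eta> by (intro mult_mono power_increasing) auto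
        then show "(1 / \<eta>0) ^ i * \<eta> ^ e \<le> (1 / \<eta>0) ^ e" by simp
      qed
      finally show ?thesis by (simp add: CB_def)
    qed
    have b00: "\<bar>b 0 x\<bar> \<le> 1 + CS + CS" for x
      using CS[of 0 "(z - x) / \<eta>"] CS[of 0 "(x - z) / \<eta>0"] by (simp add: b_def)
    define p where "p = (\<lambda>i. periodize L (b i))"
    have pd: "(p i has_real_derivative p (Suc i) x) (at x)" if "i \<le> e" for i x
      unfolding p_def by (rule periodize_has_derivative[OF bd[OF that] b0]) (use \<eta>1 e0 in auto)
    have pb: "\<bar>p i x\<bar> * \<eta> ^ e \<le> CB" if "i \<le> e" for i x
      unfolding p_def periodize_def by (rule bb[OF that])
    have p0: "p 0 x = b 0 x" if "x \<in> {L..L + 2 * pi}" for x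
    proof (cases "x = L + 2 * pi")
      case True
      have "p 0 x = b 0 L" unfolding p_def using periodize_eq[of x 1 L "b 0"] True by simp
      then show ?thesis using b0[of L 0] b0[of x 0] True \<eta>1 e0 by simp
    next
      case False
      then show ?thesis unfolding p_def using periodize_eq[of x 0 L "b 0"] that by simp
    qed
    define h where "h = (\<lambda>x. - p 0 x)"
    have hd: "(h has_real_derivative - p 1 x) (at x)" for x
      unfolding h_def using pd[of 0 x] by (auto intro!: derivative_eq_intros)
    have h: "continuous_on UNIV h" "periodic2pi h" "\<And>x. \<bar>h x\<bar> \<le> 1 + CS + CS"
      using hd periodic2pi_periodize[of L "b 0"] b00
      by (auto simp: h_def p_def periodic2pi_def periodize_def intro!: DERIV_continuous_on)
    obtain D' \<mu> where D1: "\<forall>i<m. \<forall>x. (D' i has_real_derivative D' (Suc i) x) (at x)"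
        and D2: "\<forall>i\<le>m. continuous_on UNIV (D' i) \<and> periodic2pi (D' i) \<and> (\<forall>x. \<bar>D' i x\<bar> \<le> Cm * (1 + CS + CS))"
        and D3: "D' m = (\<lambda>x. h x - \<mu>)"
      using chain[rule_format, OF h] by (elim exE conjE)
    define D where "D = (\<lambda>i. if i \<le> m then D' i else (\<lambda>x. - p (i - m) x))"
    have Dm: "D m x = - \<mu> - b 0 x" if "x \<in> {L..L + 2 * pi}" for x
      using p0[OF that] by (simp add: D_def D3 h_def)
    have bL: "b 0 x = 1 - \<sigma> ((z - x) / \<eta>)" if "x \<le> z + \<eta>0" for x
      using \<sigma>(3)[of "(x - z) / \<eta>0"] that e0 by (simp add: b_def S0 field_simps)
    have bR: "b 0 x = 1 - \<sigma> ((x - z) / \<eta>0)" if "z - \<eta> \<le> x" for x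
      using \<sigma>(3)[of "(z - x) / \<eta>"] that \<eta> by (simp add: b_def S0 field_simps)
    have zL: "z \<le> L + 2 * pi" "L \<le> z" using e0 \<eta>1 \<eta> by auto
    show "\<exists>D \<mu>. (\<forall>i<m + e. \<forall>x. (D i has_real_derivative D (Suc i) x) (at x)) \<and>
     (\<forall>i\<le>m + e. \<forall>x. \<bar>D i x\<bar> * \<eta> ^ e \<le> Cm * (1 + CS + CS) + CB + 1) \<and> periodic2pi (D 0) \<and>
     (\<forall>x y. L \<le> x \<longrightarrow> x \<le> y \<longrightarrow> y \<le> z \<longrightarrow> D m y \<le> D m x) \<and>
     (\<forall>x y. z \<le> x \<longrightarrow> x \<le> y \<longrightarrow> y \<le> L + 2 * pi \<longrightarrow> D m x \<le> D m y) \<and>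
     (\<forall>x\<in>{L..z - 2 * \<eta>}. D m x = \<mu>) \<and> (\<forall>x\<in>{z - \<eta>..z + \<eta>0}. D m x = \<mu> - 1)"
    proof (intro exI[of _ D] exI[of _ "- \<mu>"] conjI allI impI ballI)
      fix i x assume i: "i < m + e"
      consider "i < m" | "i = m" | "i > m" by linarith
      then show "(D i has_real_derivative D (Suc i) x) (at x)"
      proof cases
        case 1 then show ?thesis using D1 by (simp add: D_def)
      next
        case 2
        have "((\<lambda>x. h x - \<mu>) has_real_derivative - p 1 x) (at x)" by (auto intro!: derivative_eq_intros hd)
        then show ?thesis using 2 by (simp add: D_def D3)
      next
        case 3
        then show ?thesis using DERIV_minus[OF pd[of "i - m" x]] i by (simp add: D_def Suc_diff_le)
      qed
    next
      fix i x assume i: "i \<le> m + e"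
      show "\<bar>D i x\<bar> * \<eta> ^ e \<le> Cm * (1 + CS + CS) + CB + 1"
      proof (cases "i \<le> m")
        case True
        have "\<bar>D i x\<bar> * \<eta> ^ e \<le> (Cm * (1 + CS + CS)) * 1"
          using D2 True \<eta> \<eta>1 Cm CS0 by (intro mult_mono power_le_one) (auto simp: D_def)
        then show ?thesis using CB0 by simp
      next
        case False
        then have "\<bar>D i x\<bar> * \<eta> ^ e \<le> CB" using pb[of "i - m" x] i by (simp add: D_def)
        moreover have "0 \<le> Cm * (1 + CS + CS)" using Cm CS0 by simp
        ultimately show ?thesis by linarith
      qed
    next
      show "periodic2pi (D 0)" using D2 by (simp add: D_def)
    next
      fix x y assume xy: "L \<le> x" "x \<le> y" "y \<le> z"
      have "\<sigma> ((z - y) / \<eta>) \<le> \<sigma> ((z - x) / \<eta>)"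
        using xy \<eta> by (intro monoD[OF \<sigma>(2)] divide_right_mono) auto
      then show "D m y \<le> D m x" using xy zL e0 by (simp add: Dm bL)
    next
      fix x y assume xy: "z \<le> x" "x \<le> y" "y \<le> L + 2 * pi"
      have "\<sigma> ((x - z) / \<eta>0) \<le> \<sigma> ((y - z) / \<eta>0)"
        using xy e0 by (intro monoD[OF \<sigma>(2)] divide_right_mono) auto
      then show "D m x \<le> D m y" using xy zL \<eta> by (simp add: Dm bR)
    next
      fix x assume x: "x \<in> {L..z - 2 * \<eta>}"
      have "\<sigma> ((z - x) / \<eta>) = 1" using x \<eta> by (intro \<sigma>(4)) (simp add: field_simps)
      moreover have "x \<le> z + \<eta>0" "x \<in> {L..L + 2 * pi}" using x \<eta> e0 zL by auto
      ultimately show "D m x = - \<mu>" by (simp add: Dm bL)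
    next
      fix x assume x: "x \<in> {z - \<eta>..z + \<eta>0}"
      have "\<sigma> ((z - x) / \<eta>) = 0" using x \<eta> by (intro \<sigma>(3)) (simp add: field_simps)
      moreover have "x \<le> z + \<eta>0" "x \<in> {L..L + 2 * pi}" using x \<eta> \<eta>1 e0 zL by auto
      ultimately show "D m x = - \<mu> - 1" by (simp add: Dm bL)
    qed
  qed
qed

section \<open>Criteria for the function classes\<close>

text \<open>Convexity of the derivative of order \<open>q - 2\<close> is monotonicity of the one of
  order \<open>q - 1\<close>. The chain is required on the open interval only, so \<open>f\<close>
  may lose smoothness at a node, as it does for \<open>r = 1\<close>.\<close>

lemma q_monotone_scaledI:
  assumes q: "q \<ge> 2" and f: "continuous_on UNIV f"
    and D: "\<And>i x. i < q - 1 \<Longrightarrow> x \<in> {a<..<b} \<Longrightarrow> (D i has_real_derivative D (Suc i) x) (at x)"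
    and fD: "\<And>x. x \<in> {a<..<b} \<Longrightarrow> f x = D 0 x"
    and mono: "\<And>u v. a < u \<Longrightarrow> u \<le> v \<Longrightarrow> v < b \<Longrightarrow> c * D (q - 1) u \<le> c * D (q - 1) v"
  shows "q_monotone q a b (\<lambda>x. c * f x)"
proof -
  let ?S = "{a<..<b}"
  define D' where "D' = (\<lambda>i x. c * D i x)"
  have D': "(D' i has_real_derivative D' (Suc i) x) (at x)" if "i < q - 1" "x \<in> ?S" for i x
    unfolding D'_def by (intro DERIV_cmult D that)
  have fD': "c * f x = D' 0 x" if "x \<in> ?S" for x using fD[OF that] by (simp add: D'_def)
  have d: "(nderiv i (\<lambda>x. c * f x) has_real_derivative D' (Suc i) x) (at x)" if "i < q - 1" "x \<in> ?S" for i x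
    by (rule has_derivative_nderiv_on_open[OF open_greaterThanLessThan D' fD' that])
  have q2: "Suc (q - 2) = q - 1" "q - 2 < q - 1" using q by auto
  show ?thesis unfolding q_monotone_def Ck_open_def
  proof (intro conjI allI impI ballI)
    show "continuous_on {a..b} (\<lambda>x. c * f x)"
      by (intro continuous_intros) (use f continuous_on_subset in blast)
    show "nderiv j (\<lambda>x. c * f x) differentiable at x" if "j < q - 2" "x \<in> ?S" for j x
    proof -
      have "j < q - 1" using that by simp
      then show ?thesis using d[of j x] that by (auto simp: real_differentiable_def)
    qed
    show "continuous_on ?S (nderiv (q - 2) (\<lambda>x. c * f x))"
      using DERIV_isCont[OF d[OF q2(2)]] by (intro continuous_at_imp_continuous_on) auto
    show "convex_on ?S (nderiv (q - 2) (\<lambda>x. c * f x))"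
    proof (rule convex_on_realI[where f' = "D' (q - 1)"])
      show "connected ?S" by simp
      show "(nderiv (q - 2) (\<lambda>x. c * f x) has_real_derivative D' (q - 1) x) (at x)" if "x \<in> ?S" for x
        using d[of "q - 2" x] q2 that by simp
      show "D' (q - 1) x \<le> D' (q - 1) y" if "x \<in> ?S" "y \<in> ?S" "x \<le> y" for x y
        using mono[of x y] that by (simp add: D'_def)
    qed
  qed
qed

lemma convex_on_deriv_mono:
  fixes f :: "real \<Rightarrow> real"
  assumes "convex_on {a<..<b} f" and d: "\<And>x. (f has_real_derivative f' x) (at x)" and "a < u" "u \<le> v" "v < b"
  shows "f' u \<le> f' v"
proof (cases "u = v")
  case False
  have "f' u * (v - u) \<le> f v - f u" "f' v * (u - v) \<le> f u - f v"
    using assms by (intro convex_on_imp_above_tangent[OF assms(1)]; auto simp: interior_open intro: has_field_derivative_at_within)+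
  then have "f' u * (v - u) \<le> f' v * (v - u)" by (simp add: algebra_simps)
  then show ?thesis using False assms by simp
qed simp

lemma q_monotone_trig_poly_mono:
  assumes T: "T \<in> trig_poly n" and q: "q \<ge> 2" and m: "q_monotone q a b (\<lambda>x. c * T x)" and "a < u" "u \<le> v" "v < b"
  shows "c * nderiv (q - 1) T u \<le> c * nderiv (q - 1) T v"
proof -
  have d: "((\<lambda>x. c * nderiv i T x) has_real_derivative c * nderiv (Suc i) T x) (at x)" for i x
    by (intro DERIV_cmult trig_poly_nderiv(2)[OF T])
  have "nderiv (q - 2) (\<lambda>x. c * T x) = (\<lambda>x. c * nderiv (q - 2) T x)"
    by (rule ext, rule nderiv_eq_on_open[of UNIV "q - 2" "\<lambda>i x. c * nderiv i T x"]) (auto intro: d simp: nderiv_def[of 0])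
  then have "convex_on {a<..<b} (\<lambda>x. c * nderiv (q - 2) T x)" using m by (simp add: q_monotone_def)
  moreover have "((\<lambda>x. c * nderiv (q - 2) T x) has_real_derivative c * nderiv (q - 1) T x) (at x)" for x
    using d[of "q - 2" x] q by (metis Suc_diff_le diff_Suc_Suc numeral_2_eq_2 One_nat_def)
  ultimately show ?thesis using assms(4-6) by (rule convex_on_deriv_mono)
qed

lemma lipschitz_imp_loc_abs_cont:
  assumes "\<And>x y. \<bar>g x - g y\<bar> \<le> M * \<bar>x - y\<bar>"
  shows "loc_abs_cont g"
  unfolding loc_abs_cont_def abs_cont_on_def
proof (intro allI impI)
  fix a b \<epsilon> :: real assume \<epsilon>: "\<epsilon> > 0"
  define M' where "M' = \<bar>M\<bar> + 1"
  have M': "M' > 0" "M \<le> M'" by (auto simp: M'_def)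
  have g: "\<bar>g x - g y\<bar> \<le> M' * \<bar>x - y\<bar>" for x y
    using assms[of x y] mult_right_mono[OF M'(2), of "\<bar>x - y\<bar>"] by simp
  show "\<exists>\<delta>>0. \<forall>(n::nat) (u::nat \<Rightarrow> real) (v::nat \<Rightarrow> real). (\<forall>k<n. a \<le> u k \<and> u k \<le> v k \<and> v k \<le> b) \<and>
        (\<forall>k<n. \<forall>l<n. k \<noteq> l \<longrightarrow> v k \<le> u l \<or> v l \<le> u k) \<and> (\<Sum>k<n. v k - u k) < \<delta>
        \<longrightarrow> (\<Sum>k<n. \<bar>g (v k) - g (u k)\<bar>) < \<epsilon>"
  proof (intro exI[of _ "\<epsilon> / M'"] conjI allI impI)
    show "\<epsilon> / M' > 0" using \<epsilon> M' by simp
    fix n :: nat and u v :: "nat \<Rightarrow> real"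
    assume "(\<forall>k<n. a \<le> u k \<and> u k \<le> v k \<and> v k \<le> b) \<and>
        (\<forall>k<n. \<forall>l<n. k \<noteq> l \<longrightarrow> v k \<le> u l \<or> v l \<le> u k) \<and> (\<Sum>k<n. v k - u k) < \<epsilon> / M'"
    then have uv: "\<forall>k<n. a \<le> u k \<and> u k \<le> v k \<and> v k \<le> b" and s: "(\<Sum>k<n. v k - u k) < \<epsilon> / M'" by auto
    have "(\<Sum>k<n. \<bar>g (v k) - g (u k)\<bar>) \<le> (\<Sum>k<n. M' * (v k - u k))"
    proof (rule sum_mono)
      fix k assume "k \<in> {..<n}"
      then show "\<bar>g (v k) - g (u k)\<bar> \<le> M' * (v k - u k)" using g[of "v k" "u k"] uv by auto
    qed
    also have "\<dots> = M' * (\<Sum>k<n. v k - u k)" by (simp add: sum_distrib_left)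
    also have "\<dots> < \<epsilon>" using s M' by (simp add: field_simps)
    finally show "(\<Sum>k<n. \<bar>g (v k) - g (u k)\<bar>) < \<epsilon>" .
  qed
qed

lemma bounded_derivative_imp_lipschitz:
  fixes g :: "real \<Rightarrow> real"
  assumes "\<And>x. (g has_real_derivative g' x) (at x)" "\<And>x. \<bar>g' x\<bar> \<le> M"
  shows "\<bar>g x - g y\<bar> \<le> M * \<bar>x - y\<bar>"
  using field_differentiable_bound[of UNIV g g' M x y] assms by auto

lemma W_classI:
  assumes r: "r \<ge> 1" and D: "\<And>i x. i < r \<Longrightarrow> (D i has_real_derivative D (Suc i) x) (at x)"
    and per: "periodic2pi (D 0)" and bd: "\<And>x. \<bar>D r x\<bar> \<le> 2"
  shows "D 0 \<in> W_class r"
proof -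
  have n: "nderiv j (D 0) = D j" if "j \<le> r" for j
    using nderiv_eq_on_open[of UNIV r D "D 0" j] D that by auto
  have r1: "Suc (r - 1) = r" using r by simp
  have d: "(D (r - 1) has_real_derivative D r x) (at x)" for x using D[of "r - 1" x] r by simp
  show ?thesis unfolding W_class_def
  proof (intro CollectI conjI allI impI)
    show "nderiv j (D 0) differentiable at x" if "j < r - 1" for j x
    proof -
      have "(D j has_real_derivative D (Suc j) x) (at x)" using D that by simp
      then show ?thesis using n[of j] that by (auto simp: real_differentiable_def)
    qed
    show "loc_abs_cont (nderiv (r - 1) (D 0))"
      using n[of "r - 1"] bounded_derivative_imp_lipschitz[OF d bd] by (auto intro: lipschitz_imp_loc_abs_cont)
    show "AE x in lborel. nderiv (r - 1) (D 0) differentiable at x \<and> \<bar>nderiv r (D 0) x\<bar> \<le> 2"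
      using n[of "r - 1"] n[of r] d bd by (auto simp: real_differentiable_def)
  qed (rule per)
qed

lemma periodic2pi_trig_poly:
  assumes "T \<in> trig_poly n" shows "periodic2pi T"
proof -
  obtain a b where T: "T = (\<lambda>x. a 0 + (\<Sum>k=1..n. a k * cos (real k * x) + b k * sin (real k * x)))"
    using assms(1) by (rule trig_polyE)
  have "cos (real k * (x + 2 * pi)) = cos (real k * x)" "sin (real k * (x + 2 * pi)) = sin (real k * x)" for k x
  proof -
    have e: "real k * (x + 2 * pi) = real k * x + 2 * real k * pi" by (simp add: algebra_simps)
    show "cos (real k * (x + 2 * pi)) = cos (real k * x)" "sin (real k * (x + 2 * pi)) = sin (real k * x)"
      unfolding e cos_add sin_add by (simp_all add: cos_2npi sin_2npi)
  qed
  then show ?thesis unfolding T periodic2pi_def by simp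
qed

text \<open>Infima and suprema of reals carry information only for nonempty and bounded sets: the
  zero polynomial is admissible, and a continuous periodic difference is bounded.\<close>

lemma le_E_q:
  assumes q: "q \<ge> 2" and f: "continuous_on UNIV f" "periodic2pi f"
    and lb: "\<And>T \<epsilon>. T \<in> trig_poly n \<Longrightarrow> T \<in> Delta_q q y s \<Longrightarrow> (\<And>x. \<bar>T x - f x\<bar> \<le> \<epsilon>) \<Longrightarrow> c \<le> \<epsilon>"
  shows "c \<le> E_q q n f y s"
  unfolding E_q_def
proof (rule cINF_greatest)
  have "q_monotone q a b (\<lambda>x. c * (0::real))" for a b c
    by (rule q_monotone_scaledI[where D="\<lambda>_ _. 0" and f="\<lambda>_. 0"]) (use q in auto)
  then have "(\<lambda>x. 0) \<in> Delta_q q y s" unfolding Delta_q_def by (auto simp: periodic2pi_def)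
  then show "trig_poly n \<inter> Delta_q q y s \<noteq> {}" using trig_poly_const[of 0 n] by blast
next
  fix T assume T: "T \<in> trig_poly n \<inter> Delta_q q y s"
  have "periodic2pi (\<lambda>x. f x - T x)" using f periodic2pi_trig_poly[of T n] T by (auto simp: periodic2pi_def)
  moreover have "continuous_on UNIV (\<lambda>x. f x - T x)" using f T by (auto simp: Delta_q_def intro!: continuous_intros)
  ultimately obtain B where B: "\<And>x. \<bar>f x - T x\<bar> \<le> B" using periodic2pi_continuous_bounded by blast
  show "c \<le> sup_norm (\<lambda>x. f x - T x)"
  proof (rule lb)
    fix x
    have "\<bar>f x - T x\<bar> \<le> sup_norm (\<lambda>x. f x - T x)" unfolding sup_norm_def
      using B by (intro cSUP_upper bdd_aboveI[of _ B]) auto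
    then show "\<bar>T x - f x\<bar> \<le> sup_norm (\<lambda>x. f x - T x)" by (simp add: abs_minus_commute)
  qed (use T in auto)
qed

lemma limsup_eq_infinityI:
  assumes "strict_mono N" "\<And>k. real k \<le> X (N k)"
  shows "limsup (\<lambda>n. ereal (X n)) = \<infinity>"
proof -
  have "(\<lambda>k. ereal (X (N k))) \<longlonglongrightarrow> \<infinity>"
    unfolding tendsto_PInfty
  proof
    fix r :: real
    obtain k0 :: nat where "r < real k0" using reals_Archimedean2 by blast
    then have "r < X (N k)" if "k \<ge> k0" for k using assms(2)[of k] that
      by (meson less_le_trans of_nat_le_iff)
    then show "\<forall>\<^sub>F k in sequentially. ereal r < ereal (X (N k))"
      by (auto simp: eventually_sequentially)
  qed
  then have "limsup ((\<lambda>n. ereal (X n)) \<circ> N) = \<infinity>" by (auto intro!: lim_imp_Limsup simp: o_def)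
  moreover have "limsup ((\<lambda>n. ereal (X n)) \<circ> N) \<le> limsup (\<lambda>n. ereal (X n))"
    by (rule limsup_subseq_mono[OF assms(1)])
  ultimately show ?thesis by (simp add: top.extremum_unique flip: top_ereal_def)
qed

section \<open>Position of the nodes and the shape condition around \<open>y 1\<close>\<close>

lemma nodes_antimono:
  fixes y :: "nat \<Rightarrow> real"
  assumes "\<forall>i\<in>{1..<2 * s}. y (i + 1) < y i" "1 \<le> i" "i \<le> j" "j \<le> 2 * s"
  shows "y j \<le> y i"
  using assms(3,4)
proof (induction j rule: dec_induct)
  case (step k)
  have "y (k + 1) < y k" using assms(1,2) step by auto
  then show ?case using step by simp
qed simp

lemma nodes_bounds:
  fixes y :: "nat \<Rightarrow> real"
  assumes s: "s \<ge> 1" and y: "\<forall>i\<in>{1..<2 * s}. y (i + 1) < y i" "y 1 < y (2 * s) + 2 * pi"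
  shows "y 2 < y 1" "y (2 * s) \<le> y 2"
    "\<And>i. i \<in> {1..2 * s} \<Longrightarrow> i \<noteq> 1 \<Longrightarrow> i \<noteq> 2 \<Longrightarrow> y (2 * s) \<le> ypt y s i \<and> ypt y s (i - 1) \<le> y 2"
proof -
  show "y 2 < y 1" using y(1)[rule_format, of 1] s by (simp add: numeral_2_eq_2)
  show "y (2 * s) \<le> y 2" using nodes_antimono[OF y(1), of 2 "2 * s"] s by simp
  fix i assume "i \<in> {1..2 * s}" "i \<noteq> 1" "i \<noteq> 2"
  then show "y (2 * s) \<le> ypt y s i \<and> ypt y s (i - 1) \<le> y 2"
    using nodes_antimono[OF y(1), of i "2 * s"] nodes_antimono[OF y(1), of 2 "i - 1"] by (auto simp: ypt_def)
qed

text \<open>Only on the two intervals meeting at \<open>y 1\<close> may the derivative of order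
  \<open>q - 1\<close> vary. On the others it is constant, which suits either sign
  \<open>(-1) ^ (i - 1)\<close>. Separate chains \<open>D\<close> and \<open>E\<close> on the two
  sides demand no more than continuity at \<open>y 1\<close> itself.\<close>

lemma Delta_qI:
  fixes y :: "nat \<Rightarrow> real"
  assumes s: "s \<ge> 1" and y: "\<forall>i\<in>{1..<2 * s}. y (i + 1) < y i" "y 1 < y (2 * s) + 2 * pi"
    and q: "q \<ge> 2" and f: "continuous_on UNIV f" "periodic2pi f"
    and D: "\<And>i x. i < q - 1 \<Longrightarrow> x \<in> {y (2 * s)<..<y 1} \<Longrightarrow> (D i has_real_derivative D (Suc i) x) (at x)"
      "\<And>x. x \<in> {y (2 * s)<..<y 1} \<Longrightarrow> f x = D 0 x"
    and E: "\<And>i x. i < q - 1 \<Longrightarrow> x \<in> {y 1<..<y (2 * s) + 2 * pi} \<Longrightarrow> (E i has_real_derivative E (Suc i) x) (at x)"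
      "\<And>x. x \<in> {y 1<..<y (2 * s) + 2 * pi} \<Longrightarrow> f x = E 0 x"
    and Dm: "\<And>u v. y 2 < u \<Longrightarrow> u \<le> v \<Longrightarrow> v < y 1 \<Longrightarrow> D (q - 1) v \<le> D (q - 1) u"
      "\<And>u v. y (2 * s) < u \<Longrightarrow> u \<le> v \<Longrightarrow> v < y 2 \<Longrightarrow> D (q - 1) v = D (q - 1) u"
    and Em: "\<And>u v. y 1 < u \<Longrightarrow> u \<le> v \<Longrightarrow> v < y (2 * s) + 2 * pi \<Longrightarrow> E (q - 1) u \<le> E (q - 1) v"
  shows "f \<in> Delta_q q y s"
proof -
  note nb = nodes_bounds[OF s y]
  have "q_monotone q (ypt y s i) (ypt y s (i - 1)) (\<lambda>x. (-1) ^ (i - 1) * f x)" if i: "i \<in> {1..2 * s}" for i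
  proof -
    consider "i = 1" | "i = 2" | "i \<noteq> 1" "i \<noteq> 2" by blast
    then show ?thesis
    proof cases
      case 1
      have "q_monotone q (y 1) (y (2 * s) + 2 * pi) (\<lambda>x. 1 * f x)"
        by (rule q_monotone_scaledI[OF q f(1) E]) (use Em in auto)
      then show ?thesis using 1 by (simp add: ypt_def)
    next
      case 2
      have "q_monotone q (y 2) (y 1) (\<lambda>x. - 1 * f x)"
        by (rule q_monotone_scaledI[OF q f(1) D]) (use Dm nb in auto)
      then show ?thesis using 2 by (simp add: ypt_def)
    next
      case 3
      have "q_monotone q (ypt y s i) (ypt y s (i - 1)) (\<lambda>x. (-1) ^ (i - 1) * f x)"
      proof (rule q_monotone_scaledI[OF q f(1) D])
        fix u v assume "ypt y s i < u" "u \<le> v" "v < ypt y s (i - 1)"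
        then show "(-1) ^ (i - 1) * D (q - 1) u \<le> (-1) ^ (i - 1) * D (q - 1) v"
          using Dm(2)[of u v] nb(3)[OF i 3] by simp
      qed (use nb(1,2) nb(3)[OF i 3] in auto)
      then show ?thesis .
    qed
  qed
  then show ?thesis using f by (simp add: Delta_q_def)
qed

lemma mono_on_closed_left:
  fixes g :: "real \<Rightarrow> real"
  assumes "isCont g a" "\<And>u v. a < u \<Longrightarrow> u \<le> v \<Longrightarrow> v < b \<Longrightarrow> g u \<le> g v"
  shows "mono_on {a..<b} g"
proof (rule mono_onI)
  fix u v assume uv: "u \<in> {a..<b}" "v \<in> {a..<b}" "u \<le> v"
  show "g u \<le> g v"
  proof (cases "u = a \<and> u < v")
    case True
    have "(g \<longlongrightarrow> g a) (at_right a)" using assms(1) by (simp add: isCont_def filterlim_at_split)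
    moreover have "\<forall>\<^sub>F t in at_right a. g t \<le> g v"
      unfolding eventually_at_right[of a v] using True uv assms(2)
      by (subst eventually_at_right[of a v]) (auto intro!: exI[of _ v])
    ultimately have "g a \<le> g v" by (rule tendsto_upperbound) simp
    then show ?thesis using True by simp
  next
    case False
    then show ?thesis using uv assms(2)[of u v] by (cases "u = v") auto
  qed
qed

text \<open>A trigonometric polynomial is smooth across \<open>y 1\<close>, so the monotonicity on
  the two open intervals, with signs -1 and +1, extends by continuity to \<open>y 1\<close>. This is
  all that the lower bounds use of admissibility.\<close>

lemma Delta_q_trig_poly_trough:
  fixes y :: "nat \<Rightarrow> real"
  assumes s: "s \<ge> 1" and q: "q \<ge> 2" and T: "T \<in> trig_poly n" "T \<in> Delta_q q y s"
    and w: "0 < w" "y 2 < y 1 - w" "y 1 + w < y (2 * s) + 2 * pi"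
  shows "mono_on {y 1..y 1 + w} (nderiv (q - 1) T)" "antimono_on {y 1 - w..y 1} (nderiv (q - 1) T)"
proof -
  define g where "g = nderiv (q - 1) T"
  have gc: "isCont g x" for x unfolding g_def using trig_poly_nderiv(2)[OF T(1)] DERIV_isCont by blast
  have qm: "q_monotone q (ypt y s i) (ypt y s (i - 1)) (\<lambda>x. (-1) ^ (i - 1) * T x)" if "i \<in> {1..2 * s}" for i
    using T(2) that by (simp add: Delta_q_def)
  have 1: "g u \<le> g v" if "y 1 < u" "u \<le> v" "v < y (2 * s) + 2 * pi" for u v
    using q_monotone_trig_poly_mono[OF T(1) q qm[of 1], of u v] s that by (simp add: ypt_def g_def)
  have 2: "g v \<le> g u" if "y 2 < u" "u \<le> v" "v < y 1" for u v
    using q_monotone_trig_poly_mono[OF T(1) q qm[of 2], of u v] s that by (simp add: ypt_def g_def)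
  have "mono_on {y 1..<y (2 * s) + 2 * pi} g" by (rule mono_on_closed_left[OF gc 1])
  then show "mono_on {y 1..y 1 + w} (nderiv (q - 1) T)" unfolding g_def
    by (rule mono_on_subset) (use w in auto)
  \<comment> \<open>Reflection turns the right end point of the left interval into a left one, so
    that \<open>mono_on_closed_left\<close> applies again.\<close>
  have "isCont (\<lambda>x. g (- x)) (- y 1)" by (intro continuous_intros isCont_o2[OF _ gc])
  then have "mono_on {- y 1..< - y 2} (\<lambda>x. g (- x))"
    by (rule mono_on_closed_left) (rule 2; simp)
  then have "g v \<le> g u" if "y 2 < u" "u \<le> v" "v \<le> y 1" for u v
    using that monotone_onD[of "{- y 1..< - y 2}" "(\<le>)" "(\<le>)" "\<lambda>x. g (- x)" "- v" "- u"] by auto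
  then show "antimono_on {y 1 - w..y 1} (nderiv (q - 1) T)"
    unfolding g_def[symmetric] using w by (intro monotone_onI) auto
qed

section \<open>Lipschitz functions and the triangle wave\<close>

lemma lipschitz_deriv_bound:
  fixes g :: "real \<Rightarrow> real"
  assumes "\<And>x y. \<bar>g x - g y\<bar> \<le> M * \<bar>x - y\<bar>" "(g has_real_derivative d) (at x)"
  shows "\<bar>d\<bar> \<le> M"
proof -
  have "((\<lambda>h. \<bar>(g (x + h) - g x) / h\<bar>) \<longlongrightarrow> \<bar>d\<bar>) (at 0)" using assms(2) by (intro tendsto_rabs) (simp add: DERIV_def)
  moreover have "\<bar>(g (x + h) - g x) / h\<bar> \<le> M" if "h \<noteq> 0" for h
    using assms(1)[of "x + h" x] that by (simp add: abs_divide field_simps)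
  then have "\<forall>\<^sub>F h in at 0. \<bar>(g (x + h) - g x) / h\<bar> \<le> M" by (auto simp: eventually_at intro: exI[of _ 1])
  ultimately show ?thesis by (intro tendsto_upperbound[of _ "\<bar>d\<bar>" "at 0"]) auto
qed

text \<open>The distance from \<open>x\<close> to the multiples of \<open>2 * pi\<close>.\<close>

definition triangle_wave :: "real \<Rightarrow> real" where "triangle_wave x = arccos (cos x)"

lemma triangle_wave_bounds: "0 \<le> triangle_wave x" "triangle_wave x \<le> pi"
  unfolding triangle_wave_def by (auto intro: arccos_lbound arccos_ubound)

lemma triangle_wave_le: "triangle_wave x \<le> \<bar>x - 2 * of_int k * pi\<bar>"
proof -
  have "cos x = cos (\<bar>x - 2 * of_int k * pi\<bar>)"
    using cos_eq[of x "x - 2 * of_int k * pi"] by (auto intro!: bexI[of _ "of_int k"])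
  then show ?thesis
    using triangle_wave_bounds[of x] arccos_cos[of "\<bar>x - 2 * of_int k * pi\<bar>"] unfolding triangle_wave_def by fastforce
qed

lemma triangle_wave_lipschitz: "\<bar>triangle_wave x - triangle_wave y\<bar> \<le> \<bar>x - y\<bar>"
proof -
  have *: "triangle_wave x \<le> triangle_wave y + \<bar>x - y\<bar>" for x y
  proof -
    have "cos y = cos (triangle_wave y)" by (simp add: triangle_wave_def)
    then obtain n where n: "n \<in> \<int>" "y = triangle_wave y + 2 * n * pi \<or> y = - triangle_wave y + 2 * n * pi" unfolding cos_eq by blast
    then obtain k where k: "n = of_int k" by (auto elim: Ints_cases)
    have "\<bar>y - 2 * of_int k * pi\<bar> = triangle_wave y" using n triangle_wave_bounds[of y] unfolding k by linarith
    then show ?thesis using triangle_wave_le[of x k] by linarith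
  qed
  show ?thesis using *[of x y] *[of y x] by linarith
qed

text \<open>The parabola \<open>t (t - 2 pi)\<close> is invariant under
  \<open>t \<mapsto> 2 pi - t\<close>, which removes the kinks of the wave at odd multiples of
  \<open>pi\<close> and leaves those at multiples of \<open>2 * pi\<close>. Up to scaling and an
  additive constant, the composite is the periodic Bernoulli polynomial of degree 2.\<close>

lemma triangle_wave_parabola:
  assumes "\<bar>x\<bar> \<le> 2 * pi" shows "triangle_wave x * (triangle_wave x - 2 * pi) = \<bar>x\<bar> * (\<bar>x\<bar> - 2 * pi)"
proof (cases "\<bar>x\<bar> \<le> pi")
  case True
  then have "triangle_wave x = \<bar>x\<bar>" unfolding triangle_wave_def using arccos_cos[of "\<bar>x\<bar>"] by simp
  then show ?thesis by simp
next
  case False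
  have "cos (2 * pi - \<bar>x\<bar>) = cos x" by (simp add: cos_diff)
  then have "triangle_wave x = 2 * pi - \<bar>x\<bar>" unfolding triangle_wave_def using arccos_cos[of "2 * pi - \<bar>x\<bar>"] False assms by simp
  then show ?thesis by (simp only:) (simp add: algebra_simps)
qed

section \<open>The case of order one\<close>

text \<open>Here \<open>m\<close> is \<open>q - 2\<close>. Near both ends of the window the
  derivative of \<open>T\<close> of order \<open>q - 1\<close> must come close to
  \<open>- 2 * c\<close>, and between the control points it is largest at the ends, so it is at most
  \<open>- 2 * c + K1 * \<epsilon>\<close> throughout. Nothing makes up for the jump
  \<open>4 * pi * c\<close> one order below. The degree of \<open>T\<close> never enters, so the
  bound is the same for all \<open>n\<close>.\<close>

lemma upward_jump_not_approximable:
  fixes w c z :: real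
  assumes w: "0 < w" and c: "0 < c"
  shows "\<exists>\<delta>>0. \<forall>n T f D E \<epsilon>. T \<in> trig_poly n \<longrightarrow>
     mono_on {z..z+w} (nderiv (Suc m) T) \<longrightarrow> antimono_on {z-w..z} (nderiv (Suc m) T) \<longrightarrow>
     (\<forall>i<Suc m. \<forall>x\<in>{z-w..<z}. (D i has_real_derivative D (Suc i) x) (at x)) \<longrightarrow>
     (\<forall>i<Suc m. \<forall>x\<in>{z<..z+w}. (E i has_real_derivative E (Suc i) x) (at x)) \<longrightarrow>
     (\<forall>x\<in>{z-w..<z}. D 0 x = f x \<and> D m x = - c * (2 * (x - z) + 2 * pi) \<and> D (Suc m) x = - 2 * c) \<longrightarrow>
     (\<forall>x\<in>{z<..z+w}. E 0 x = f x \<and> E m x = - c * (2 * (x - z) - 2 * pi) \<and> E (Suc m) x = - 2 * c) \<longrightarrow>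
     (\<forall>x. \<bar>T x - f x\<bar> \<le> \<epsilon>) \<longrightarrow> \<delta> \<le> \<epsilon>"
proof -
  have w4: "0 < w / 4" using w by simp
  obtain K1 where K1: "K1 > 0" and KK1: "\<And>\<alpha> G \<epsilon>. (\<forall>i<Suc m. \<forall>x\<in>{\<alpha>..\<alpha> + w/4}. (G i has_real_derivative G (Suc i) x) (at x))
     \<Longrightarrow> (\<forall>x\<in>{\<alpha>..\<alpha> + w/4}. \<bar>G 0 x\<bar> \<le> \<epsilon>) \<Longrightarrow> (\<exists>\<xi>\<in>{\<alpha>..\<alpha> + w/4}. \<bar>G (Suc m) \<xi>\<bar> \<le> K1 * \<epsilon>)"
    using small_derivative_point[OF w4, of "Suc m"] by metis
  obtain K2 where K2: "K2 > 0" and KK2: "\<And>\<alpha> G \<epsilon>. (\<forall>i<m. \<forall>x\<in>{\<alpha>..\<alpha> + w/4}. (G i has_real_derivative G (Suc i) x) (at x))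
     \<Longrightarrow> (\<forall>x\<in>{\<alpha>..\<alpha> + w/4}. \<bar>G 0 x\<bar> \<le> \<epsilon>) \<Longrightarrow> (\<exists>\<xi>\<in>{\<alpha>..\<alpha> + w/4}. \<bar>G m \<xi>\<bar> \<le> K2 * \<epsilon>)"
    using small_derivative_point[OF w4, of m] by metis
  define \<delta> where "\<delta> = 4 * pi * c / (2 * K2 + 2 * w * K1)"
  have den: "2 * K2 + 2 * w * K1 > 0" using K1 K2 w by (simp add: add_pos_pos)
  show ?thesis
  proof (intro exI[of _ \<delta>] conjI allI impI, goal_cases)
    case 1 show ?case using den c by (simp add: \<delta>_def)
  next
    case (2 n T f D E \<epsilon>)
    note T = 2(1) and mo = 2(2) and an = 2(3) and D = 2(4) and E = 2(5) and Dv = 2(6) and Ev = 2(7) and app = 2(8)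
    let ?N = "\<lambda>i. nderiv i T"
    have N: "(?N i has_real_derivative ?N (Suc i) x) (at x)" for i x by (rule trig_poly_nderiv(2)[OF T])
    have N0: "?N 0 = T" by (simp add: nderiv_def)
    have e0: "0 \<le> \<epsilon>" using app abs_ge_zero order_trans by blast
    define GD where "GD = (\<lambda>i x. ?N i x - D i x)"
    define GE where "GE = (\<lambda>i x. ?N i x - E i x)"
    have GD: "(GD i has_real_derivative GD (Suc i) x) (at x)" if "i < Suc m" "x \<in> {z-w..<z}" for i x
      unfolding GD_def using N D that by (auto intro!: derivative_intros)
    have GE: "(GE i has_real_derivative GE (Suc i) x) (at x)" if "i < Suc m" "x \<in> {z<..z+w}" for i x
      unfolding GE_def using N E that by (auto intro!: derivative_intros)
    have GD0: "\<bar>GD 0 x\<bar> \<le> \<epsilon>" if "x \<in> {z-w..<z}" for x using app Dv that by (simp add: GD_def N0)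
    have GE0: "\<bar>GE 0 x\<bar> \<le> \<epsilon>" if "x \<in> {z<..z+w}" for x using app Ev that by (simp add: GE_def N0)
    have "\<exists>\<xi>\<in>{z - w..z - w + w/4}. \<bar>GD (Suc m) \<xi>\<bar> \<le> K1 * \<epsilon>"
      using w by (intro KK1) (auto intro!: GD GD0)
    then obtain p1 where p1: "p1 \<in> {z - w..z - 3/4*w}" "\<bar>GD (Suc m) p1\<bar> \<le> K1 * \<epsilon>" using w by force
    have "\<exists>\<xi>\<in>{z + 3/4*w..z + 3/4*w + w/4}. \<bar>GE (Suc m) \<xi>\<bar> \<le> K1 * \<epsilon>"
      using w by (intro KK1) (auto intro!: GE GE0)
    then obtain p2 where p2: "p2 \<in> {z + 3/4*w..z + w}" "\<bar>GE (Suc m) p2\<bar> \<le> K1 * \<epsilon>" using w by force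
    have "\<exists>\<xi>\<in>{z - 3/4*w..z - 3/4*w + w/4}. \<bar>GD m \<xi>\<bar> \<le> K2 * \<epsilon>"
      using w by (intro KK2) (auto intro!: GD GD0)
    then obtain p3 where p3: "p3 \<in> {z - 3/4*w..z - w/2}" "\<bar>GD m p3\<bar> \<le> K2 * \<epsilon>" using w by force
    have "\<exists>\<xi>\<in>{z + w/2..z + w/2 + w/4}. \<bar>GE m \<xi>\<bar> \<le> K2 * \<epsilon>"
      using w by (intro KK2) (auto intro!: GE GE0)
    then obtain p4 where p4: "p4 \<in> {z + w/2..z + 3/4*w}" "\<bar>GE m p4\<bar> \<le> K2 * \<epsilon>" using w by force
    have "D (Suc m) p1 = - 2 * c" "E (Suc m) p2 = - 2 * c" using Dv Ev p1 p2 w by auto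
    then have b: "?N (Suc m) p1 \<le> - 2 * c + K1 * \<epsilon>" "?N (Suc m) p2 \<le> - 2 * c + K1 * \<epsilon>"
      using p1(2) p2(2) by (auto simp: GD_def GE_def)
    have bN: "?N (Suc m) x \<le> - 2 * c + K1 * \<epsilon>" if "p1 \<le> x" "x \<le> p2" for x
    proof (cases "x \<le> z")
      case True
      have "?N (Suc m) x \<le> ?N (Suc m) p1" using an True that p1 w by (auto simp: monotone_on_def)
      then show ?thesis using b by linarith
    next
      case False
      have "?N (Suc m) x \<le> ?N (Suc m) p2" using mo False that p2 w by (auto simp: monotone_on_def)
      then show ?thesis using b by linarith
    qed
    have lt: "p3 < p4" using p3 p4 w by auto
    obtain t where t: "p3 < t" "t < p4" "?N m p4 - ?N m p3 = (p4 - p3) * ?N (Suc m) t"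
      using MVT2[OF lt, of "?N m" "?N (Suc m)"] N by blast
    have "?N m p4 - ?N m p3 \<le> (p4 - p3) * (- 2 * c + K1 * \<epsilon>)"
      unfolding t(3) using t p1 p2 p3 p4 lt by (intro mult_left_mono bN) auto
    moreover have "D m p3 = - c * (2 * (p3 - z) + 2 * pi)" "E m p4 = - c * (2 * (p4 - z) - 2 * pi)"
      using Dv Ev p3 p4 w by auto
    ultimately have "- c * (2 * (p4 - z) - 2 * pi) - - c * (2 * (p3 - z) + 2 * pi) - 2 * (K2 * \<epsilon>) \<le> (p4 - p3) * (- 2 * c + K1 * \<epsilon>)"
      using p3(2) p4(2) unfolding GD_def GE_def by linarith
    \<comment> \<open>The terms \<open>- 2 * c * (p4 - p3)\<close> on both sides cancel, which
      isolates the jump.\<close>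
    then have "4 * pi * c \<le> 2 * (K2 * \<epsilon>) + (p4 - p3) * (K1 * \<epsilon>)" by (simp add: algebra_simps)
    also have "\<dots> \<le> 2 * (K2 * \<epsilon>) + (2 * w) * (K1 * \<epsilon>)"
      using p3 p4 w K1 e0 by (intro add_left_mono mult_right_mono) auto
    finally have "4 * pi * c \<le> \<epsilon> * (2 * K2 + 2 * w * K1)" by (simp add: algebra_simps)
    then show ?case using den by (simp add: \<delta>_def pos_divide_le_eq)
  qed
qed

lemma no_jackson_estimate_order_one:
  fixes y :: "nat \<Rightarrow> real"
  assumes q: "q \<ge> 3" and s: "s \<ge> 1" and y: "\<forall>i\<in>{1..<2 * s}. y (i + 1) < y i" "y 1 < y (2 * s) + 2 * pi"
  shows "\<exists>f \<in> Delta_q q y s \<inter> W_class 1. limsup (\<lambda>n. ereal (real n ^ 1 * E_q q n f y s)) = \<infinity>"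
proof -
  note nb = nodes_bounds[OF s y]
  define z where "z = y 1"
  define L where "L = y (2 * s)"
  have zL: "L < z" "z < L + 2 * pi" using nb y by (auto simp: z_def L_def)
  define k where "k = q - 3"
  have qk: "q = k + 3" using q by (simp add: k_def)
  obtain Cm where Cm: "Cm \<ge> 0" and chain: "\<forall>h B. continuous_on UNIV h \<longrightarrow> periodic2pi h \<longrightarrow> (\<forall>x. \<bar>h x\<bar> \<le> B) \<longrightarrow>
    (\<exists>D \<mu>. (\<forall>i<k. \<forall>x. (D i has_real_derivative D (Suc i) x) (at x)) \<and>
      (\<forall>i\<le>k. continuous_on UNIV (D i) \<and> periodic2pi (D i) \<and> (\<forall>x. \<bar>D i x\<bar> \<le> Cm * B)) \<and> D k = (\<lambda>x. h x - \<mu>))"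
    using periodic_iterated_antiderivative[of k] by (elim exE conjE)
  \<comment> \<open>The first entry makes \<open>h\<close> Lipschitz with constant 2, as needed for
    \<open>q = 3\<close>; the second bounds \<open>P 1\<close> by 2, as needed for
    \<open>q > 3\<close>.\<close>
  define c where "c = min (1 / pi) (2 / (Cm * (2 * pi\<^sup>2) + 1))"
  have den: "Cm * (2 * pi\<^sup>2) + 1 > 0" using Cm by (simp add: add_nonneg_pos)
  have c: "c > 0" "c * (2 * pi) \<le> 2" "Cm * (c * (2 * pi\<^sup>2)) \<le> 2"
  proof -
    show "c > 0" using den by (simp add: c_def)
    have "c * pi \<le> 1 / pi * pi" by (intro mult_right_mono) (auto simp: c_def)
    then show "c * (2 * pi) \<le> 2" by simp
    have "c * (Cm * (2 * pi\<^sup>2) + 1) \<le> 2 / (Cm * (2 * pi\<^sup>2) + 1) * (Cm * (2 * pi\<^sup>2) + 1)"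
      using den by (intro mult_right_mono) (auto simp: c_def)
    also have "\<dots> = 2" using den by (metis less_irrefl nonzero_eq_divide_eq)
    finally show "Cm * (c * (2 * pi\<^sup>2)) \<le> 2" using \<open>c > 0\<close> by (simp add: algebra_simps)
  qed
  define K where "K = (\<lambda>x. triangle_wave (x - z) * (triangle_wave (x - z) - 2 * pi))"
  define h where "h = (\<lambda>x. - c * K x)"
  have Klip: "\<bar>K x - K x'\<bar> \<le> (2 * pi) * \<bar>x - x'\<bar>" for x x'
  proof -
    have "K x - K x' = (triangle_wave (x - z) + triangle_wave (x' - z) - 2 * pi) * (triangle_wave (x - z) - triangle_wave (x' - z))"
      by (simp add: K_def algebra_simps)
    then have "\<bar>K x - K x'\<bar> = \<bar>triangle_wave (x - z) + triangle_wave (x' - z) - 2 * pi\<bar> * \<bar>triangle_wave (x - z) - triangle_wave (x' - z)\<bar>"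
      by (simp add: abs_mult)
    also have "\<dots> \<le> (2 * pi) * \<bar>x - x'\<bar>"
      using triangle_wave_bounds[of "x - z"] triangle_wave_bounds[of "x' - z"] triangle_wave_lipschitz[of "x - z" "x' - z"]
      by (intro mult_mono) auto
    finally show ?thesis .
  qed
  have hlip: "\<bar>h x - h x'\<bar> \<le> 2 * \<bar>x - x'\<bar>" for x x'
  proof -
    have "\<bar>h x - h x'\<bar> = c * \<bar>K x - K x'\<bar>"
      using c(1) by (simp add: h_def abs_mult abs_minus_commute flip: right_diff_distrib)
    also have "\<dots> \<le> c * ((2 * pi) * \<bar>x - x'\<bar>)" using c Klip by (intro mult_left_mono) auto
    also have "\<dots> = (c * (2 * pi)) * \<bar>x - x'\<bar>" by simp
    also have "\<dots> \<le> 2 * \<bar>x - x'\<bar>" using c by (intro mult_right_mono) auto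
    finally show ?thesis .
  qed
  have h: "continuous_on UNIV h" "periodic2pi h" "\<And>x. \<bar>h x\<bar> \<le> c * (2 * pi\<^sup>2)"
  proof -
    show "continuous_on UNIV h" unfolding h_def K_def triangle_wave_def
      by (intro continuous_intros continuous_on_arccos) auto
    have "x + 2 * pi - z = (x - z) + 2 * pi" for x by simp
    then have "triangle_wave (x + 2 * pi - z) = triangle_wave (x - z)" for x unfolding triangle_wave_def by (metis cos_periodic)
    then show "periodic2pi h" by (simp add: periodic2pi_def h_def K_def)
    fix x
    have "\<bar>K x\<bar> \<le> pi * (2 * pi)" unfolding K_def abs_mult using triangle_wave_bounds[of "x - z"] by (intro mult_mono) auto
    then show "\<bar>h x\<bar> \<le> c * (2 * pi\<^sup>2)" unfolding h_def abs_mult using c(1)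
      by (simp add: power2_eq_square mult_left_mono)
  qed
  obtain P \<mu> where P1: "\<forall>i<k. \<forall>x. (P i has_real_derivative P (Suc i) x) (at x)"
        and P2: "\<forall>i\<le>k. continuous_on UNIV (P i) \<and> periodic2pi (P i) \<and> (\<forall>x. \<bar>P i x\<bar> \<le> Cm * (c * (2 * pi\<^sup>2)))"
        and P3: "P k = (\<lambda>x. h x - \<mu>)"
    using chain[rule_format, OF h] by (elim exE conjE)
  \<comment> \<open>Up to level \<open>k\<close> both chains are the periodic one of
    \<open>f\<close>; above, they follow the explicit branch of \<open>- c * K\<close>, with
    \<open>\<tau> = 2 * pi\<close> left of \<open>z\<close> and \<open>\<tau> = - 2 * pi\<close>
    right of it. The branches differ at level \<open>k + 1 = q - 2\<close>, where the jump sits, and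
    agree again at level \<open>q - 1\<close>.\<close>
  define Q where "Q = (\<lambda>\<tau> i. if i \<le> k then P i else if i = Suc k then (\<lambda>x. - c * (2 * (x - z) + \<tau>))
      else if i = Suc (Suc k) then (\<lambda>x. - 2 * c) else (\<lambda>x. 0))"
  define D where "D = Q (2 * pi)"
  define E where "E = Q (- 2 * pi)"
  have Qd: "(Q \<tau> i has_real_derivative Q \<tau> (Suc i) x) (at x)"
    if S: "open S" "x \<in> S" "\<And>x. x \<in> S \<Longrightarrow> K x = (x - z) * ((x - z) + \<tau>)" for \<tau> i x S
  proof -
    consider "i < k" | "i = k" | "i = Suc k" | "i > Suc k" by linarith
    then show ?thesis
    proof cases
      case 1 then show ?thesis using P1 by (simp add: Q_def)
    next
      case 2
      have "((\<lambda>x. - c * ((x - z) * ((x - z) + \<tau>)) - \<mu>) has_real_derivative - c * (2 * (x - z) + \<tau>)) (at x)"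
        by (auto intro!: derivative_eq_intros simp: algebra_simps)
      then have "((\<lambda>x. h x - \<mu>) has_real_derivative - c * (2 * (x - z) + \<tau>)) (at x)"
        by (rule has_field_derivative_transform_within_open[OF _ S(1,2)]) (simp add: h_def S(3))
      then show ?thesis using 2 by (simp add: Q_def P3)
    next
      case 3
      have "((\<lambda>x. - c * (2 * (x - z) + \<tau>)) has_real_derivative - 2 * c) (at x)"
        by (auto intro!: derivative_eq_intros)
      then show ?thesis using 3 by (simp add: Q_def)
    next
      case 4 then show ?thesis by (simp add: Q_def)
    qed
  qed
  have Dd: "(D i has_real_derivative D (Suc i) x) (at x)" if "x \<in> {z - 2 * pi<..<z}" for i x
    unfolding D_def
  proof (rule Qd[OF _ that])
    fix x assume "x \<in> {z - 2 * pi<..<z}"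
    then show "K x = (x - z) * ((x - z) + 2 * pi)"
      using triangle_wave_parabola[of "x - z"] by (simp add: K_def algebra_simps)
  qed simp
  have Ed: "(E i has_real_derivative E (Suc i) x) (at x)" if "x \<in> {z<..<z + 2 * pi}" for i x
    unfolding E_def
  proof (rule Qd[OF _ that])
    fix x assume "x \<in> {z<..<z + 2 * pi}"
    then show "K x = (x - z) * ((x - z) + - 2 * pi)"
      using triangle_wave_parabola[of "x - z"] by (simp add: K_def)
  qed simp
  define f where "f = P 0"
  have f: "continuous_on UNIV f" "periodic2pi f" using P2 by (auto simp: f_def)
  have D0: "D 0 = f" and E0: "E 0 = f" by (auto simp: D_def E_def Q_def f_def)
  have q1: "q - 1 = Suc (Suc k)" using qk by simp
  have "f \<in> Delta_q q y s"
  proof (rule Delta_qI[OF s y _ f, where D = D and E = E], unfold z_def[symmetric] L_def[symmetric] q1)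
    show "D (Suc (Suc k)) v \<le> D (Suc (Suc k)) u" for u v by (simp add: D_def Q_def)
    show "E (Suc (Suc k)) u \<le> E (Suc (Suc k)) v" for u v by (simp add: E_def Q_def)
    show "D (Suc (Suc k)) v = D (Suc (Suc k)) u" for u v by (simp add: D_def Q_def)
  qed (use q zL in \<open>auto simp: D0 E0 intro!: Dd Ed\<close>)
  moreover have "f \<in> W_class 1"
  proof -
    have lip: "\<bar>f x - f x'\<bar> \<le> 2 * \<bar>x - x'\<bar>" for x x'
    proof (cases "k = 0")
      case True
      then show ?thesis using hlip P3 by (simp add: f_def)
    next
      case False
      show ?thesis
      proof (rule bounded_derivative_imp_lipschitz)
        show "(f has_real_derivative P 1 x) (at x)" for x using P1 False by (simp add: f_def)
        show "\<bar>P 1 x\<bar> \<le> 2" for x using P2 False c(3) by (metis less_one linorder_le_less_linear order_trans)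
      qed
    qed
    \<comment> \<open>For \<open>q = 3\<close> the function has corners, but only at the translates
      of \<open>z\<close>, a null set; elsewhere a shift by periods brings \<open>x\<close> into the
      interval covered by \<open>E\<close>.\<close>
    have diff: "f differentiable at x" if "x \<notin> range (\<lambda>j::int. z - of_int j * (2 * pi))" for x
    proof -
      obtain j :: int where j: "x + of_int j * (2 * pi) \<in> {z..<z + 2 * pi}" by (rule period_representative)
      moreover have "x + of_int j * (2 * pi) \<noteq> z" using that by (auto simp: image_iff algebra_simps)
      ultimately have "(E 0 has_real_derivative E 1 (x + of_int j * (2 * pi))) (at (x + of_int j * (2 * pi)))"
        using Ed[of "x + of_int j * (2 * pi)" 0] by auto
      then have "((\<lambda>t. f (t + of_int j * (2 * pi))) has_real_derivative E 1 (x + of_int j * (2 * pi))) (at x)"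
        by (simp add: E0 DERIV_shift)
      then show ?thesis using periodic2pi_int[OF f(2)] by (auto simp: real_differentiable_def)
    qed
    have d2: "\<bar>deriv f x\<bar> \<le> 2" if "f differentiable at x" for x
      using lipschitz_deriv_bound[OF lip] that DERIV_deriv_iff_real_differentiable by blast
    have "AE x in lborel. x \<notin> range (\<lambda>j::int. z - of_int j * (2 * pi))"
      by (intro AE_not_in countable_imp_null_set_lborel) auto
    then have "AE x in lborel. nderiv 0 f differentiable at x \<and> \<bar>nderiv 1 f x\<bar> \<le> 2"
      by (rule AE_mp) (auto simp: nderiv_def intro!: AE_I2 diff d2)
    then show ?thesis using f(2) lipschitz_imp_loc_abs_cont[OF lip] by (simp add: W_class_def nderiv_def)
  qed
  moreover have "limsup (\<lambda>n. ereal (real n ^ 1 * E_q q n f y s)) = \<infinity>"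
  proof -
    define w where "w = min (z - y 2) (L + 2 * pi - z) / 2"
    have w: "0 < w" "y 2 < z - w" "z + w < L + 2 * pi"
      using nb(1) zL by (auto simp: w_def z_def min_def field_simps)
    have w2: "w < pi" "w < 2 * pi" using w nb(2) zL by (auto simp: L_def)
    obtain \<delta> where \<delta>: "\<delta> > 0" and lb: "\<forall>n T f D E \<epsilon>. T \<in> trig_poly n \<longrightarrow>
     mono_on {z..z+w} (nderiv (Suc (Suc k)) T) \<longrightarrow> antimono_on {z-w..z} (nderiv (Suc (Suc k)) T) \<longrightarrow>
     (\<forall>i<Suc (Suc k). \<forall>x\<in>{z-w..<z}. (D i has_real_derivative D (Suc i) x) (at x)) \<longrightarrow>
     (\<forall>i<Suc (Suc k). \<forall>x\<in>{z<..z+w}. (E i has_real_derivative E (Suc i) x) (at x)) \<longrightarrow>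
     (\<forall>x\<in>{z-w..<z}. D 0 x = f x \<and> D (Suc k) x = - c * (2 * (x - z) + 2 * pi) \<and> D (Suc (Suc k)) x = - 2 * c) \<longrightarrow>
     (\<forall>x\<in>{z<..z+w}. E 0 x = f x \<and> E (Suc k) x = - c * (2 * (x - z) - 2 * pi) \<and> E (Suc (Suc k)) x = - 2 * c) \<longrightarrow>
     (\<forall>x. \<bar>T x - f x\<bar> \<le> \<epsilon>) \<longrightarrow> \<delta> \<le> \<epsilon>"
      using upward_jump_not_approximable[OF w(1) c(1), of z "Suc k"] by (elim exE conjE)
    have E: "\<delta> \<le> E_q q n f y s" for n
    proof (rule le_E_q[OF _ f])
      fix T \<epsilon> assume T: "T \<in> trig_poly n" "T \<in> Delta_q q y s" and app: "\<And>x. \<bar>T x - f x\<bar> \<le> \<epsilon>"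
      have tr: "mono_on {z..z + w} (nderiv (Suc (Suc k)) T)" "antimono_on {z - w..z} (nderiv (Suc (Suc k)) T)"
        using Delta_q_trig_poly_trough[OF s _ T, of w, folded z_def L_def, unfolded q1] q w by auto
      show "\<delta> \<le> \<epsilon>"
        by (rule lb[rule_format, OF T(1) tr, of D E f])
          (use w2 app in \<open>auto simp: D0 E0 intro!: Dd Ed, auto simp: D_def E_def Q_def\<close>)
    qed (use q in auto)
    obtain M :: nat where M: "1 / \<delta> < real M" using reals_Archimedean2 by blast
    then have M': "1 \<le> real M * \<delta>" using \<delta> by (simp add: field_simps)
    show ?thesis
    proof (rule limsup_eq_infinityI[where N = "\<lambda>k. Suc M * k"])
      show "strict_mono (\<lambda>k. Suc M * k)" by (auto simp: strict_mono_def simp del: mult_Suc)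
      fix j :: nat
      have "real j * 1 \<le> real j * (real M * \<delta>)" using M' by (intro mult_left_mono) auto
      also have "\<dots> \<le> real (Suc M * j) * \<delta>" using \<delta> by (simp add: algebra_simps)
      also have "\<dots> \<le> real (Suc M * j) ^ 1 * E_q q (Suc M * j) f y s"
        using E[of "Suc M * j"] by (simp add: mult_left_mono del: mult_Suc)
      finally show "real j \<le> real (Suc M * j) ^ 1 * E_q q (Suc M * j) f y s" by simp
    qed
  qed
  ultimately show ?thesis by blast
qed

section \<open>The gliding hump\<close>

text \<open>The expression is a positive constant times \<open>n ^ (r - e - 1)\<close>, with
  exponent at least 1; the constant may be arbitrarily small.\<close>

lemma resonance_degree_exists:
  fixes \<kappa> c :: real
  assumes "0 < \<kappa>" "0 < c" "Suc e < r"
  shows "\<exists>n>n0. real k \<le> real n ^ r * (\<kappa> * (c * (\<kappa> / real n) ^ e) / real n / 2)"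
proof -
  define A where "A = \<kappa> * c * \<kappa> ^ e / 2"
  have A: "A > 0" using assms by (simp add: A_def)
  obtain M :: nat where M: "real k / A < real M" using reals_Archimedean2 by blast
  define n where "n = Suc (n0 + M)"
  have n: "real n > 0" "n > n0" by (auto simp: n_def)
  have "real k \<le> A * real M" using M A by (simp add: field_simps)
  also have "\<dots> \<le> A * real n" using A by (intro mult_left_mono) (auto simp: n_def)
  finally have "real k \<le> A * real n" .
  also have "A * real n \<le> A * real n ^ (r - Suc e)"
    using A assms(3) self_le_power[of "real n" "r - Suc e"] by (intro mult_left_mono) (auto simp: n_def)
  also have "\<dots> = real n ^ r * (\<kappa> * (c * (\<kappa> / real n) ^ e) / real n / 2)"
  proof -
    have "real n ^ r = real n ^ (r - Suc e) * real n ^ e * real n"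
      using assms(3) by (simp flip: power_add power_Suc2)
    then show ?thesis using n by (simp add: A_def power_divide)
  qed
  finally show ?thesis using n by blast
qed

lemma geometric_tail_bound:
  fixes c :: "nat \<Rightarrow> real"
  assumes c: "\<And>k. 0 < c k" "\<And>k. c (Suc k) \<le> c k / 2" and g: "\<And>k. \<bar>g k\<bar> \<le> C * c k" and C: "0 \<le> C"
  shows "summable g" "\<bar>\<Sum>i. g (i + k)\<bar> \<le> 2 * C * c k"
proof -
  have ck: "c (i + k) \<le> c k * (1 / 2) ^ i" for i k
  proof (induction i)
    case (Suc i)
    have "c (Suc i + k) \<le> c (i + k) / 2" using c(2)[of "i + k"] by simp
    then show ?case using Suc by simp
  qed simp
  have gb: "norm (g (i + k)) \<le> C * c k * (1 / 2) ^ i" for i k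
  proof -
    have "norm (g (i + k)) \<le> C * c (i + k)" using g[of "i + k"] by simp
    also have "\<dots> \<le> C * (c k * (1 / 2) ^ i)" using ck[of i k] C by (intro mult_left_mono) auto
    finally show ?thesis by simp
  qed
  have sm: "summable (\<lambda>i. C * c k * (1 / 2) ^ i)" for k by (intro summable_mult summable_geometric) simp
  show "summable g" using summable_comparison_test'[OF sm[of 0], of 0 g] gb[of _ 0] by simp
  have "norm (\<Sum>i. g (i + k)) \<le> (\<Sum>i. C * c k * (1 / 2) ^ i)"
    by (rule norm_suminf_le[OF gb sm])
  also have "\<dots> = 2 * C * c k" by (simp add: suminf_mult summable_geometric suminf_geometric)
  finally show "\<bar>\<Sum>i. g (i + k)\<bar> \<le> 2 * C * c k" by simp
qed

text \<open>The \<open>k\<close>-th hump lives at scale \<open>\<eta> k\<close> left of \<open>y 1\<close> and is invisible to trigonometric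
  polynomials of degree \<open>N k\<close>, with \<open>\<eta> k\<close> of order \<open>1 / N k\<close>; on the window \<open>W k = \<eta> (k - 1)\<close> the earlier
  humps are polynomials of degree less than \<open>q\<close>, and the later ones are negligible.\<close>

lemma no_jackson_estimate_order_ge_two:
  fixes y :: "nat \<Rightarrow> real"
  assumes q: "q \<ge> 3" and r: "r \<ge> 2" and s: "s \<ge> 1"
    and y: "\<forall>i\<in>{1..<2 * s}. y (i + 1) < y i" "y 1 < y (2 * s) + 2 * pi"
  shows "\<exists>f \<in> Delta_q q y s \<inter> W_class r. limsup (\<lambda>n. ereal (real n ^ r * E_q q n f y s)) = \<infinity>"
proof -
  note nb = nodes_bounds[OF s y]
  define z where "z = y 1"
  define L where "L = y (2 * s)"
  have zL: "L < z" "z < L + 2 * pi" "L \<le> y 2" "y 2 < z" using nb y by (auto simp: z_def L_def)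
  define m where "m = q - 1"
  \<comment> \<open>Truncated subtraction: for \<open>r \<le> q - 1\<close> the class bounds no
    derivative beyond order \<open>q - 1\<close>, so \<open>e = 0\<close> and a hump needs no
    damping by its scale. In all cases \<open>e + 1 < r\<close>, thanks to \<open>m \<ge> 2\<close>
    and \<open>r \<ge> 2\<close>.\<close>
  define e where "e = r - m"
  define p where "p = q - 2"
  have mp: "m = Suc p" "q - 1 = m" using q by (auto simp: m_def p_def)
  have er: "Suc e < r" "r \<le> m + e" using q r by (auto simp: e_def m_def)
  define w0 where "w0 = min 1 (min (z - y 2) (L + 2 * pi - z) / 4)"
  have w0: "0 < w0" "w0 \<le> 1" "z + 2 * w0 < L + 2 * pi" "y 2 < z - 2 * w0" "L < z - 2 * w0"
    using zL by (auto simp: w0_def min_def field_simps)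
  obtain C where C: "C > 0" and hump: "\<forall>\<eta>. 0 < \<eta> \<longrightarrow> \<eta> \<le> w0 \<longrightarrow> (\<exists>D \<mu>.
     (\<forall>i<m + e. \<forall>x. (D i has_real_derivative D (Suc i) x) (at x)) \<and>
     (\<forall>i\<le>m + e. \<forall>x. \<bar>D i x\<bar> * \<eta> ^ e \<le> C) \<and> periodic2pi (D 0) \<and>
     (\<forall>x y. L \<le> x \<longrightarrow> x \<le> y \<longrightarrow> y \<le> z \<longrightarrow> D m y \<le> D m x) \<and>
     (\<forall>x y. z \<le> x \<longrightarrow> x \<le> y \<longrightarrow> y \<le> L + 2 * pi \<longrightarrow> D m x \<le> D m y) \<and>
     (\<forall>x\<in>{L..z - 2 * \<eta>}. D m x = \<mu>) \<and> (\<forall>x\<in>{z - \<eta>..z + w0}. D m x = \<mu> - 1))"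
    using hump_exists[OF w0(1,2,3) w0(2,5), of m e] by (elim exE conjE)
  \<comment> \<open>The constant depends on the window, and windows arise during the construction,
    so it becomes a function \<open>\<kappa>\<close> of the width; its values outside
    \<open>(0, w0]\<close> are arbitrary.\<close>
  have "\<forall>w. \<exists>\<kappa>. 0 < w \<longrightarrow> w \<le> w0 \<longrightarrow> \<kappa> > 0 \<and> \<kappa> \<le> w / 8 \<and> (\<forall>n z T F a b \<eta> \<epsilon>. 1 \<le> n \<longrightarrow> T \<in> trig_poly n \<longrightarrow>
     (\<forall>i<m. \<forall>x\<in>{z-w..z+w}. (F i has_real_derivative F (Suc i) x) (at x)) \<longrightarrow>
     mono_on {z..z+w} (nderiv m T) \<longrightarrow> antimono_on {z-w..z} (nderiv m T) \<longrightarrow>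
     0 < a \<longrightarrow> 0 < \<eta> \<longrightarrow> \<eta> \<le> \<kappa> / real n \<longrightarrow>
     (\<forall>x\<in>{z-w..z-2*\<eta>}. F m x = b) \<longrightarrow> (\<forall>x\<in>{z-2*\<eta>..z}. b - a \<le> F m x) \<longrightarrow>
     (\<forall>x\<in>{z..z+w}. F m x = b - a) \<longrightarrow>
     (\<forall>x\<in>{z-w..z+w}. \<bar>T x - F 0 x\<bar> \<le> \<epsilon>) \<longrightarrow> \<kappa> * a / real n \<le> \<epsilon>)"
    (is "\<forall>w. \<exists>\<kappa>. 0 < w \<longrightarrow> w \<le> w0 \<longrightarrow> \<kappa> > 0 \<and> \<kappa> \<le> w / 8 \<and> ?Stage w \<kappa>")
  proof
    fix w :: real
    show "\<exists>\<kappa>. 0 < w \<longrightarrow> w \<le> w0 \<longrightarrow> \<kappa> > 0 \<and> \<kappa> \<le> w / 8 \<and> ?Stage w \<kappa>"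
    proof (cases "0 < w \<and> w \<le> w0")
      case True
      then have "0 < w" "w < pi" using w0 pi_gt3 by auto
      from step_approximation_lower_bound[OF this, of p]
      show ?thesis unfolding mp(1)[symmetric] by blast
    qed auto
  qed
  from choice[OF this] obtain \<kappa> where \<kappa>': "\<forall>w. 0 < w \<longrightarrow> w \<le> w0 \<longrightarrow> \<kappa> w > 0 \<and> \<kappa> w \<le> w / 8 \<and> ?Stage w (\<kappa> w)" ..
  note \<kappa> = \<kappa>'[rule_format, THEN conjunct1] \<kappa>'[rule_format, THEN conjunct2, THEN conjunct1]
  note stage = \<kappa>'[rule_format, THEN conjunct2, THEN conjunct2]
  \<comment> \<open>The error forced at a stage: \<open>\<kappa> * a / n\<close> with
    \<open>a = c * \<eta> ^ e\<close> and \<open>\<eta> = \<kappa> / n\<close>.\<close>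
  define \<tau> where "\<tau> = (\<lambda>w c n. \<kappa> w * (c * (\<kappa> w / real n) ^ e) / real n)"
  have \<tau>: "\<tau> w c n > 0" if "0 < w" "w \<le> w0" "0 < c" "1 \<le> n" for w c n
    using \<kappa>(1)[OF that(1,2)] that by (simp add: \<tau>_def)
  define P where "P = (\<lambda>k (w, c, n). 0 < w \<and> w \<le> w0 \<and> 0 < c \<and> C * c \<le> 1 \<and> 1 \<le> n \<and> real k \<le> real n ^ r * (\<tau> w c n / 2))"
  \<comment> \<open>A state holds window, weight and degree. The next window is the scale
    \<open>\<eta>\<close> of the current hump. The bound on \<open>C * c'\<close> makes the sum of
    all later humps, at most \<open>2 * C * c'\<close>, no larger than half of the forced
    error.\<close>
  define R where "R = (\<lambda>(k::nat) (w, c, n) (w', c', n'). w' = \<kappa> w / real n \<and> c' \<le> c / 2 \<and> C * c' \<le> \<tau> w c n / 4 \<and> n < (n'::nat))"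
  have "\<exists>\<phi>. \<forall>k. P k (\<phi> k) \<and> R k (\<phi> k) (\<phi> (Suc k))"
  proof (rule dependent_nat_choice)
    obtain n where "n > 0" "real 0 \<le> real n ^ r * (\<tau> w0 (1 / C) n / 2)"
      unfolding \<tau>_def using resonance_degree_exists[OF \<kappa>(1)[of w0] _ er(1), of "1 / C" 0 0] w0 C by auto
    then have "P 0 (w0, 1 / C, n)" using w0 C by (simp add: P_def)
    then show "\<exists>x. P 0 x" by blast
  next
    fix x :: "real \<times> real \<times> nat" and k :: nat
    assume Px: "P k x"
    obtain w c n where x: "x = (w, c, n)" by (cases x)
    have P: "0 < w" "w \<le> w0" "0 < c" "C * c \<le> 1" "1 \<le> n" using Px by (auto simp: x P_def)
    define w' where "w' = \<kappa> w / real n"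
    define c' where "c' = min (c / 2) (\<tau> w c n / (4 * C))"
    have "\<kappa> w / real n \<le> \<kappa> w / 1" using P \<kappa>(1)[of w] by (intro divide_left_mono) auto
    then have w': "0 < w'" "w' \<le> w0" using P \<kappa>[of w] by (auto simp: w'_def)
    have c': "0 < c'" "c' \<le> c / 2" "C * c' \<le> \<tau> w c n / 4"
      using P C \<tau>[of w c n] by (auto simp: c'_def min_def field_simps)
    have "C * c' \<le> C * c" using c' P C by (intro mult_left_mono) auto
    then have Cc': "C * c' \<le> 1" using P by linarith
    obtain n' where n': "n' > n" "real (Suc k) \<le> real n' ^ r * (\<tau> w' c' n' / 2)"
      unfolding \<tau>_def using resonance_degree_exists[OF \<kappa>(1)[OF w'] c'(1) er(1), of n "Suc k"] by auto
    have "P (Suc k) (w', c', n')" using w' c' Cc' n' P by (simp add: P_def)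
    moreover have "R k x (w', c', n')" using c' n' by (simp add: R_def x w'_def)
    ultimately show "\<exists>y. P (Suc k) y \<and> R k x y" by blast
  qed
  then obtain \<phi> where \<phi>: "\<And>k. P k (\<phi> k)" "\<And>k. R k (\<phi> k) (\<phi> (Suc k))" by blast
  define W c N where "W = (\<lambda>k. fst (\<phi> k))" and "c = (\<lambda>k. fst (snd (\<phi> k)))" and "N = (\<lambda>k. snd (snd (\<phi> k)))"
  have \<phi>e: "\<phi> k = (W k, c k, N k)" for k by (simp add: W_def c_def N_def)
  have PW: "0 < W k" "W k \<le> w0" "0 < c k" "C * c k \<le> 1" "1 \<le> N k" "real k \<le> real (N k) ^ r * (\<tau> (W k) (c k) (N k) / 2)" for k
    using \<phi>(1)[of k] unfolding \<phi>e P_def by auto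
  have RW: "W (Suc k) = \<kappa> (W k) / real (N k)" "c (Suc k) \<le> c k / 2" "C * c (Suc k) \<le> \<tau> (W k) (c k) (N k) / 4" "N k < N (Suc k)" for k
    using \<phi>(2)[of k] unfolding \<phi>e R_def by auto
  define \<eta> where "\<eta> = (\<lambda>k. W (Suc k))"
  have \<eta>: "0 < \<eta> k" "\<eta> k \<le> w0" for k using PW by (auto simp: \<eta>_def)
  have Wdec: "W (Suc k) \<le> W k / 8" for k
  proof -
    have "W (Suc k) \<le> \<kappa> (W k) / 1" unfolding RW(1) using PW[of k] \<kappa>(1)[of "W k"] by (intro divide_left_mono) auto
    then show ?thesis using \<kappa>(2)[of "W k"] PW[of k] by simp
  qed
  have Wmono: "W k \<le> \<eta> j" if "j < k" for j k
  proof -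
    have "decseq W"
    proof (rule decseq_SucI)
      fix k show "W (Suc k) \<le> W k" using Wdec[of k] PW(1)[of k] by linarith
    qed
    then show ?thesis using that by (simp add: \<eta>_def decseqD)
  qed
  have "\<forall>k. \<exists>D \<mu>.
     (\<forall>i<m + e. \<forall>x. (D i has_real_derivative D (Suc i) x) (at x)) \<and>
     (\<forall>i\<le>m + e. \<forall>x. \<bar>D i x\<bar> * \<eta> k ^ e \<le> C) \<and> periodic2pi (D 0) \<and>
     (\<forall>x y. L \<le> x \<longrightarrow> x \<le> y \<longrightarrow> y \<le> z \<longrightarrow> D m y \<le> D m x) \<and>
     (\<forall>x y. z \<le> x \<longrightarrow> x \<le> y \<longrightarrow> y \<le> L + 2 * pi \<longrightarrow> D m x \<le> D m y) \<and>
     (\<forall>x\<in>{L..z - 2 * \<eta> k}. D m x = \<mu>) \<and> (\<forall>x\<in>{z - \<eta> k..z + w0}. D m x = \<mu> - 1)"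
    using hump \<eta> by blast
  from choice[OF this] obtain H where "\<forall>k. \<exists>\<mu>.
     (\<forall>i<m + e. \<forall>x. (H k i has_real_derivative H k (Suc i) x) (at x)) \<and>
     (\<forall>i\<le>m + e. \<forall>x. \<bar>H k i x\<bar> * \<eta> k ^ e \<le> C) \<and> periodic2pi (H k 0) \<and>
     (\<forall>x y. L \<le> x \<longrightarrow> x \<le> y \<longrightarrow> y \<le> z \<longrightarrow> H k m y \<le> H k m x) \<and>
     (\<forall>x y. z \<le> x \<longrightarrow> x \<le> y \<longrightarrow> y \<le> L + 2 * pi \<longrightarrow> H k m x \<le> H k m y) \<and>
     (\<forall>x\<in>{L..z - 2 * \<eta> k}. H k m x = \<mu>) \<and> (\<forall>x\<in>{z - \<eta> k..z + w0}. H k m x = \<mu> - 1)" ..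
  from choice[OF this] obtain \<mu> where H: "\<forall>k.
     (\<forall>i<m + e. \<forall>x. (H k i has_real_derivative H k (Suc i) x) (at x)) \<and>
     (\<forall>i\<le>m + e. \<forall>x. \<bar>H k i x\<bar> * \<eta> k ^ e \<le> C) \<and> periodic2pi (H k 0) \<and>
     (\<forall>x y. L \<le> x \<longrightarrow> x \<le> y \<longrightarrow> y \<le> z \<longrightarrow> H k m y \<le> H k m x) \<and>
     (\<forall>x y. z \<le> x \<longrightarrow> x \<le> y \<longrightarrow> y \<le> L + 2 * pi \<longrightarrow> H k m x \<le> H k m y) \<and>
     (\<forall>x\<in>{L..z - 2 * \<eta> k}. H k m x = \<mu> k) \<and> (\<forall>x\<in>{z - \<eta> k..z + w0}. H k m x = \<mu> k - 1)" ..
  \<comment> \<open>The factor \<open>\<eta> k ^ e\<close> offsets the growth of the derivatives up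
    to order \<open>m + e\<close> and leaves the summable bound \<open>C * c k\<close>.\<close>
  define a where "a = (\<lambda>k. c k * \<eta> k ^ e)"
  have a: "a k > 0" for k using PW \<eta> by (simp add: a_def)
  define u where "u = (\<lambda>i k x. a k * H k i x)"
  have ud: "(u i k has_real_derivative u (Suc i) k x) (at x)" if "i < m + e" for i k x
    unfolding u_def using H that by (intro DERIV_cmult) auto
  have ub: "\<bar>u i k x\<bar> \<le> C * c k" if "i \<le> m + e" for i k x
  proof -
    have "\<bar>u i k x\<bar> = c k * (\<bar>H k i x\<bar> * \<eta> k ^ e)" using PW(3)[of k] \<eta>(1)[of k] by (simp add: u_def a_def abs_mult)
    also have "\<dots> \<le> c k * C" using H that PW(3)[of k] by (intro mult_left_mono) auto
    finally show ?thesis by (simp add: mult.commute)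
  qed
  have uper: "u 0 k (x + 2 * pi) = u 0 k x" for k x using H by (simp add: u_def periodic2pi_def)
  have uL: "u m k x' \<le> u m k x" if "L \<le> x" "x \<le> x'" "x' \<le> z" for k x x'
    unfolding u_def using H that a[of k] by (intro mult_left_mono) auto
  have uR: "u m k x \<le> u m k x'" if "z \<le> x" "x \<le> x'" "x' \<le> L + 2 * pi" for k x x'
    unfolding u_def using H that a[of k] by (intro mult_left_mono) auto
  have uc: "u m k x = a k * \<mu> k" if "L \<le> x" "x \<le> z - 2 * \<eta> k" for k x using H that by (simp add: u_def)
  have uz: "u m k x = a k * \<mu> k - a k" if "z - \<eta> k \<le> x" "x \<le> z + w0" for k x
  proof -
    have "H k m x = \<mu> k - 1" using H that by simp
    then show ?thesis by (simp add: u_def right_diff_distrib)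
  qed
  have C0: "0 \<le> C" using C by simp
  note tail = geometric_tail_bound[of c, OF PW(3) RW(2) _ C0]
  have usum: "summable (\<lambda>k. u i k x)" if "i \<le> m + e" for i x by (rule tail(1)[OF ub[OF that]])
  define D where "D = (\<lambda>i x. \<Sum>k. u i k x)"
  have Dd: "(D i has_real_derivative D (Suc i) x) (at x)" if "i < m + e" for i x
  proof -
    have cs: "summable (\<lambda>k. C * c k)" by (rule tail(1)) (use C PW(3) in \<open>auto simp: abs_mult less_imp_le\<close>)
    have "uniformly_convergent_on UNIV (\<lambda>n x. \<Sum>k<n. u (Suc i) k x)"
      by (rule Weierstrass_m_test'[OF _ cs]) (use ub[of "Suc i"] that in auto)
    then show ?thesis unfolding D_def
      using has_field_derivative_series'(2)[of UNIV "u i" "u (Suc i)" x x] ud[OF that] usum[of i x] that by auto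
  qed
  \<comment> \<open>The weights at least halve and \<open>C * c 0 \<le> 1\<close>, so the series
    stays within the bound 2 of \<open>W_class\<close>.\<close>
  have Db: "\<bar>D i x\<bar> \<le> 2" if "i \<le> m + e" for i x
  proof -
    have "\<bar>D i x\<bar> \<le> 2 * C * c 0" using tail(2)[where k = 0, OF ub[OF that, where x = x]] by (simp add: D_def)
    then show ?thesis using PW(4)[of 0] by linarith
  qed
  define f where "f = D 0"
  have f: "continuous_on UNIV f" "periodic2pi f"
    using DERIV_continuous_on[OF Dd[of 0]] uper mp by (auto simp: f_def periodic2pi_def D_def)
  have um: "summable (\<lambda>k. u m k x)" for x by (rule usum) simp
  have "f \<in> Delta_q q y s"
  proof (rule Delta_qI[OF s y _ f, where D = D and E = D]; (unfold mp z_def[symmetric] L_def[symmetric])?)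
    fix x x' assume xx: "y 2 < x" "x \<le> x'" "x' < z"
    show "D (Suc p) x' \<le> D (Suc p) x" unfolding D_def mp(1)[symmetric]
      by (rule suminf_le[OF _ um um]) (use xx zL in \<open>auto intro: uL\<close>)
  next
    fix x x' assume xx: "z < x" "x \<le> x'" "x' < L + 2 * pi"
    show "D (Suc p) x \<le> D (Suc p) x'" unfolding D_def mp(1)[symmetric]
      by (rule suminf_le[OF _ um um]) (use xx zL in \<open>auto intro: uR\<close>)
  next
    \<comment> \<open>Left of \<open>y 2\<close> every hump is still on its upper plateau, as
      \<open>2 * \<eta> k \<le> 2 * w0 < z - y 2\<close>.\<close>
    fix x x' assume xx: "L < x" "x \<le> x'" "x' < y 2"
    have "u m k x' = u m k x" for k
    proof -
      have "x' \<le> z - 2 * \<eta> k" using xx w0 \<eta>(2)[of k] by linarith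
      then show ?thesis using uc[of x' k] uc[of x k] xx by simp
    qed
    then show "D (Suc p) x' = D (Suc p) x" unfolding D_def mp(1)[symmetric] by simp
  qed (use q mp in \<open>auto simp: f_def intro!: Dd\<close>)
  moreover have "f \<in> W_class r" unfolding f_def
    by (rule W_classI) (use r er f Db in \<open>auto simp: f_def intro!: Dd\<close>)
  moreover have "limsup (\<lambda>n. ereal (real n ^ r * E_q q n f y s)) = \<infinity>"
  proof (rule limsup_eq_infinityI[where N = N])
    show "strict_mono N" using RW(4) by (intro strict_mono_Suc_iff[THEN iffD2]) auto
    fix k :: nat
    have "\<tau> (W k) (c k) (N k) / 2 \<le> E_q q (N k) f y s"
    proof (rule le_E_q[OF _ f])
      fix T \<epsilon> assume T: "T \<in> trig_poly (N k)" "T \<in> Delta_q q y s" and app: "\<And>x. \<bar>T x - f x\<bar> \<le> \<epsilon>"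
      have w: "0 < W k" "W k \<le> w0" "y 2 < z - W k" "z + W k < L + 2 * pi" "L \<le> z - W k"
        using PW(1,2)[of k] w0 by auto
      have tr: "mono_on {z..z + W k} (nderiv m T)" "antimono_on {z - W k..z} (nderiv m T)"
        using Delta_q_trig_poly_trough[OF s _ T, of "W k", folded z_def L_def, unfolded mp(2)] q w by auto
      define F where "F = (\<lambda>i x. \<Sum>j<Suc k. u i j x)"
      \<comment> \<open>On the left part of the window the earlier humps are already on their lower
        plateau, hump \<open>k\<close> still on its upper one.\<close>
      define b where "b = (\<Sum>j<k. a j * \<mu> j - a j) + a k * \<mu> k"
      have early: "(\<Sum>j<k. u m j x) = (\<Sum>j<k. a j * \<mu> j - a j)" if "x \<in> {z - W k..z + W k}" for x
      proof (intro sum.cong refl uz)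
        fix j assume "j \<in> {..<k}"
        then have "W k \<le> \<eta> j" by (simp add: Wmono)
        then show "z - \<eta> j \<le> x" "x \<le> z + w0" using that w by auto
      qed
      have \<eta>W: "8 * \<eta> k \<le> W k" using Wdec[of k] by (simp add: \<eta>_def)
      \<comment> \<open>\<open>T\<close> approximates the partial sum \<open>F\<close> up to
        \<open>\<epsilon> + \<tau> / 2\<close>, the second term being the tail; the stage bound
        \<open>\<tau> \<le> \<epsilon> + \<tau> / 2\<close> still leaves half of
        \<open>\<tau>\<close>.\<close>
      have "\<kappa> (W k) * a k / real (N k) \<le> \<epsilon> + \<tau> (W k) (c k) (N k) / 2"
      proof (rule stage[rule_format, OF w(1,2) PW(5) T(1) _ tr a \<eta>(1), where F = F and b = b])
        show "(F i has_real_derivative F (Suc i) x) (at x)" if "i < m" "x \<in> {z - W k..z + W k}" for i x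
          unfolding F_def using that by (intro DERIV_sum ud) auto
        show "\<eta> k \<le> \<kappa> (W k) / real (N k)" by (simp add: \<eta>_def RW(1))
        show "F m x = b" if "x \<in> {z - W k..z - 2 * \<eta> k}" for x
          using early[of x] uc[of x k] that w \<eta>(1)[of k] by (auto simp: F_def b_def)
        show "F m x = b - a k" if "x \<in> {z..z + W k}" for x
          using early[of x] uz[of k x] that w \<eta>(1)[of k] by (auto simp: F_def b_def)
        show "b - a k \<le> F m x" if "x \<in> {z - 2 * \<eta> k..z}" for x
          using early[of x] uz[of k z] uL[of x z k] that w w0 \<eta>(1)[of k] \<eta>W by (auto simp: F_def b_def)
        show "\<bar>T x - F 0 x\<bar> \<le> \<epsilon> + \<tau> (W k) (c k) (N k) / 2" if "x \<in> {z - W k..z + W k}" for x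
        proof -
          have "f x = (\<Sum>j. u 0 (j + Suc k) x) + F 0 x"
            unfolding f_def D_def F_def by (rule suminf_split_initial_segment[OF usum]) simp
          moreover have "\<bar>\<Sum>j. u 0 (j + Suc k) x\<bar> \<le> 2 * C * c (Suc k)"
            by (rule tail(2)[OF ub]) simp
          ultimately show ?thesis using app[of x] RW(3)[of k] by linarith
        qed
      qed
      moreover have "\<kappa> (W k) * a k / real (N k) = \<tau> (W k) (c k) (N k)"
        by (simp add: \<tau>_def a_def \<eta>_def RW(1))
      ultimately show "\<tau> (W k) (c k) (N k) / 2 \<le> \<epsilon>" by linarith
    qed (use q in auto)
    then have "real (N k) ^ r * (\<tau> (W k) (c k) (N k) / 2) \<le> real (N k) ^ r * E_q q (N k) f y s"
      by (intro mult_left_mono) auto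
    then show "real k \<le> real (N k) ^ r * E_q q (N k) f y s" using PW(6)[of k] by linarith
  qed
  ultimately show ?thesis by blast
qed

theorem theorem1p2:
  fixes q r s :: nat and y :: "nat \<Rightarrow> real"
  assumes "q \<ge> 3" and "r \<ge> 1" and "s \<ge> 1"
    and "\<forall>i\<in>{1..<2 * s}. y (i + 1) < y i"
    and "y 1 < y (2 * s) + 2 * pi"
  shows "\<exists>f \<in> Delta_q q y s \<inter> W_class r.
           limsup (\<lambda>n. ereal (real n ^ r * E_q q n f y s)) = \<infinity>"
proof (cases "r = 1")
  case True
  then show ?thesis using no_jackson_estimate_order_one[OF assms(1,3-5)] by simp
next
  case False
  then have "r \<ge> 2" using assms(2) by simp
  then show ?thesis using no_jackson_estimate_order_ge_two[OF assms(1) _ assms(3-5)] by simp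
qed

end
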